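(* Let $\mathbb{R}^+=[0,+\infty)$, $\nu_1,\nu_2\in\mathbb{R}$, let $J\subseteq\mathbb{R}$ be an open interval (bounded or unbounded), $\Phi:J\to\mathbb{R}$ a continuous function, $k:\mathbb{R}^+\to\mathbb{R}$ a measurable function with $k(t)>0$ for a.e. $t>0$ and $\frac1k\in L^1(\mathbb{R}^+)$, and $f:\mathbb{R}^+\times\mathbb{R}^2\to\mathbb{R}$ a Carathéodory function. Set $k_\infty:=\|1/k\|_{L^1(\mathbb{R}^+)}$, $s_\infty^*:=\frac{\nu_2-\nu_1}{k_\infty}$ and, for $t>0$, $k_t:=\|1/k\|_{L^1([0,t])}$, $s_t^*:=\frac{\nu_2-\nu_1}{k_t}$. Let $J^*\subseteq J$ be an open interval, symmetric with respect to $0$, with $s_\infty^*\in J^*$, on which $\Phi$ is strictly monotone and odd. Suppose there exists a value $T>0$ such that $s_T^*\in J^*$. Finally, assume that there exists a function $\psi\in L^1(\mathbb{R}^+)$ such that $$\Phi(s_T^* )\pm 2\|\psi\|_{L^1(\mathbb{R}^+)}\in\Phi(J^* )$$ and $$|f(t,x,y(t))|\le\psi(t)\quad\text{for a.e. } t\in\mathbb{R}^+,$$ for every $x\in\mathbb{R}$ and every $y\in L^1(\mathbb{R}^+)$ such that $$|x|<|\nu_1|+k_\infty\,\Phi^{-1}\left(\Phi(|s_T^*|)+2\|\psi\|_{L^1(\mathbb{R}^+)}\right),$$ $$|y(t)|<\frac{1}{k(t)}\,\Phi^{-1}\left(\Phi(|s_T^*|)+2\|\psi\|_{L^1(\mathbb{R}^+)}\right)\quad\text{for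 a.e. } t\in\mathbb{R}^+.$$ Then the problem $$\begin{cases}\left(\Phi(k(t)x'(t))\right)'=f(t,x(t),x'(t))\quad\text{for a.e. } t\in\mathbb{R}^+,\\ x(0)=\nu_1,\quad x(+\infty)=\nu_2\end{cases}$$ admits a solution.
   Context: $\Phi^{-1}$ denotes the partial inverse of $\Phi$, defined on $\Phi(J^* )$ and taking values in $J^*$. A solution of the half-line problem is a function $x\in W^{1,1}_{\mathrm{loc}}([0,+\infty))$ such that: $x(0)=\nu_1$ and $\lim_{t\to+\infty}x(t)=\nu_2$; $\Phi\circ(kx')\in W^{1,1}_{\mathrm{loc}}([0,+\infty))$ (i.e. it agrees a.e. with a locally absolutely continuous function); and $(\Phi(k(t)x'(t)))'=f(t,x(t),x'(t))$ for a.e. $t\ge 0$. Carathéodory function: $f(\cdot,x,y)$ is measurable for every $(x,y)$, and $f(t,\cdot,\cdot)$ is continuous for a.e. $t$.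
   Formalization: The case ν₁=ν₂ with ‖ψ‖=0 is excluded (there the condition on f is vacuous and the claim fails), and for strictly decreasing Φ the bound is taken as Φ⁻¹(Φ(|s_T*|)−2‖ψ‖) instead of Φ⁻¹(Φ(|s_T*|)+2‖ψ‖), with which the claim is false. *)

theory Defs
  imports "HOL-Analysis.Analysis"
begin

definition L1norm :: "real set \<Rightarrow> (real \<Rightarrow> real) \<Rightarrow> real" where
  "L1norm S g = integral\<^sup>L (lebesgue_on S) (\<lambda>t. \<bar>g t\<bar>)"

definition abs_cont_on :: "real \<Rightarrow> real \<Rightarrow> (real \<Rightarrow> real) \<Rightarrow> bool" where
  "abs_cont_on a b g \<longleftrightarrow>
     (\<forall>\<epsilon>>0. \<exists>\<delta>>0. \<forall>(n::nat) (u :: nat \<Rightarrow> real) (v :: nat \<Rightarrow> real).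
        (\<forall>i<n. a \<le> u i \<and> u i \<le> v i \<and> v i \<le> b) \<longrightarrow>
        (\<forall>i<n. \<forall>j<n. i \<noteq> j \<longrightarrow> {u i<..<v i} \<inter> {u j<..<v j} = {}) \<longrightarrow>
        (\<Sum>i<n. v i - u i) < \<delta> \<longrightarrow>
        (\<Sum>i<n. \<bar>g (v i) - g (u i)\<bar>) < \<epsilon>)"

text \<open>The continuous representatives of the elements of \<open>W\<^sup>1\<^sup>,\<^sup>1\<close>-loc of \<open>[0, \<infinity>)\<close>.\<close>

definition locally_abs_cont :: "(real \<Rightarrow> real) \<Rightarrow> bool" where
  "locally_abs_cont g \<longleftrightarrow> (\<forall>b>0. abs_cont_on 0 b g)"

definition caratheodory :: "(real \<Rightarrow> real \<Rightarrow> real \<Rightarrow> real) \<Rightarrow> bool" where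
  "caratheodory f \<longleftrightarrow>
     (\<forall>x y. (\<lambda>t. f t x y) \<in> borel_measurable (lebesgue_on {0..})) \<and>
     (AE t in lebesgue_on {0..}. continuous_on UNIV (\<lambda>(x, y). f t x y))"

text \<open>The function \<open>w\<close> is the locally absolutely continuous representative of \<open>\<Phi> \<circ> (k x')\<close>, and
  \<open>p\<close> is the (unique) derivative \<open>x' t\<close>. Since \<open>\<Phi>\<close> is only given on \<open>J\<close>, the expression
  \<open>\<Phi> (k t * x' t)\<close> has a meaning only if its argument lies in \<open>J\<close>.\<close>

definition half_line_solution ::
  "real set \<Rightarrow> (real \<Rightarrow> real) \<Rightarrow> (real \<Rightarrow> real) \<Rightarrow> (real \<Rightarrow> real \<Rightarrow> real \<Rightarrow> real) \<Rightarrow>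
   real \<Rightarrow> real \<Rightarrow> (real \<Rightarrow> real) \<Rightarrow> bool" where
  "half_line_solution J \<Phi> k f \<nu>1 \<nu>2 x \<longleftrightarrow>
     locally_abs_cont x \<and> x 0 = \<nu>1 \<and> (x \<longlongrightarrow> \<nu>2) at_top \<and>
     (\<exists>w. locally_abs_cont w \<and>
        (AE t in lebesgue_on {0..}. \<exists>p.
           (x has_real_derivative p) (at t) \<and>
           k t * p \<in> J \<and> w t = \<Phi> (k t * p) \<and>
           (w has_real_derivative f t (x t) p) (at t)))"

text \<open>For increasing \<open>\<Phi>\<close> the radius is \<open>\<Phi>\<inverse>(\<Phi>(\<bar>s\<bar>) + 2c)\<close>. The decreasing case is reduced to the
  increasing one by passing to \<open>-\<Phi>\<close> and \<open>-f\<close>, and then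
  \<open>(-\<Phi>)\<inverse>(-\<Phi>(\<bar>s\<bar>) + 2c) = \<Phi>\<inverse>(\<Phi>(\<bar>s\<bar>) - 2c)\<close>.\<close>

definition slope_bound :: "real set \<Rightarrow> (real \<Rightarrow> real) \<Rightarrow> real \<Rightarrow> real \<Rightarrow> real" where
  "slope_bound I \<Phi> s c =
     (if strict_mono_on I \<Phi> then the_inv_into I \<Phi> (\<Phi> \<bar>s\<bar> + 2 * c)
      else the_inv_into I \<Phi> (\<Phi> \<bar>s\<bar> - 2 * c))"

end

theory Submission
  imports Defs "HOL-Complex_Analysis.Great_Picard"
begin

text \<open>
  Write \<open>u = k x'\<close> and \<open>w = \<Phi> u\<close>. For increasing \<open>\<Phi>\<close> the problem is the first-order system
  \<open>x' = \<Phi>\<inverse> w / k\<close>, \<open>w' = f t x (\<Phi>\<inverse> w / k)\<close> with \<open>x 0 = \<nu>1\<close>, and the only unknown datum is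
  \<open>C = w 0\<close>, to be chosen so that \<open>x\<close> tends to \<open>\<nu>2\<close>. Outside the region \<open>\<bar>x\<bar> \<le> \<bar>\<nu>1\<bar> + k\<^sub>\<infinity> M\<close>,
  \<open>\<bar>w\<bar> \<le> \<Phi> M\<close> the right-hand side is frozen by clamping \<open>x\<close> and \<open>w\<close>; it then becomes a
  Caratheodory field dominated everywhere by the integrable function \<open>M / k + \<psi>\<close>.

  For the truncated system the boundary value is reached by shooting. Write \<open>c\<close> for the
  \<open>L\<^sup>1\<close>-norm of \<open>\<psi>\<close> and \<open>s = (\<nu>2 - \<nu>1) / k\<^sub>\<infinity>\<close>. Since \<open>w\<close> never moves further than \<open>c\<close>
  from \<open>C\<close>, the choice \<open>C = \<Phi> s + c\<close> forces \<open>\<Phi>\<inverse> w \<ge> s\<close>, hence a limit of \<open>x\<close> that is at least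
  \<open>\<nu>2\<close>, and \<open>C = \<Phi> s - c\<close> forces a limit that is at most \<open>\<nu>2\<close>. A true solution need not depend
  continuously on \<open>C\<close>, because the field is merely continuous in the state. Tonelli's scheme repairs
  this: with the state on the right-hand side delayed by \<open>\<delta> > 0\<close> the solution is obtained by
  finitely many integrations, so it is unique and continuous in \<open>C\<close>, and the intermediate value
  theorem yields the right \<open>C\<close> for each delay. All delayed solutions share the modulus of continuity
  of the indefinite integral of \<open>M / k + \<psi>\<close>; a subsequence converges pointwise as \<open>\<delta> \<rightarrow> 0\<close>, and
  dominated convergence passes to the limit both in the equation and in the value at infinity. This is
  the lemma \<open>shooting\<close>, and no fixed-point theorem in a function space enters.

  The solution found satisfies \<open>\<bar>w\<bar> \<le> \<bar>C\<bar> + c \<le> \<Phi> \<bar>s\<bar> + 2 c \<le> \<Phi> M\<close> and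
  \<open>\<bar>x\<bar> \<le> \<bar>\<nu>1\<bar> + k\<^sub>\<infinity> M\<close>, so it never meets the truncation; the inequality \<open>\<bar>s\<bar> \<le> \<bar>s\<^sub>T\<bar>\<close>
  is what makes the bound in terms of \<open>s\<^sub>T\<close> sufficient. Decreasing \<open>\<Phi>\<close> is reduced to increasing
  \<open>\<Phi>\<close> by changing the signs of \<open>\<Phi>\<close> and \<open>f\<close>.
\<close>

section \<open>Indefinite Lebesgue integrals\<close>

text \<open>Approximating \<open>u\<close> by functions with finitely many values reduces the claim to measurability of
  the sections \<open>\<lambda>s. H s z\<close>; continuity in the state takes the limit.\<close>

lemma borel_measurable_caratheodory_comp:
  fixes H :: "'s \<Rightarrow> 'a::{metric_space, second_countable_topology} \<Rightarrow> 'b::metric_space"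
  assumes meas: "\<And>z. (\<lambda>s. H s z) \<in> borel_measurable M"
    and cont: "\<And>s. s \<in> space M \<Longrightarrow> continuous_on UNIV (H s)"
    and u: "u \<in> borel_measurable M"
  shows "(\<lambda>s. H s (u s)) \<in> borel_measurable M"
proof -
  obtain F where F: "\<And>i. simple_function M (F i)"
      and lim: "\<And>s. s \<in> space M \<Longrightarrow> (\<lambda>i. F i s) \<longlonglongrightarrow> u s"
    using borel_measurable_implies_sequence_metric[OF u] by blast
  have "(\<lambda>s. H s (F i s)) \<in> borel_measurable M" for i
  proof (rule measurable_compose_countable'[where g = "F i" and I = "F i ` space M" and f = "\<lambda>z s. H s z"])
    show "F i \<in> measurable M (count_space (F i ` space M))"
      using F[of i] unfolding simple_function_def
      by (auto simp: measurable_count_space_eq2)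
    show "countable (F i ` space M)"
      using F[of i] by (simp add: simple_function_def countable_finite)
  qed (rule meas)
  moreover have "(\<lambda>i. H s (F i s)) \<longlonglongrightarrow> H s (u s)" if "s \<in> space M" for s
    using continuous_on_tendsto_compose[OF cont[OF that] lim[OF that]] by simp
  ultimately show ?thesis
    by (rule borel_measurable_LIMSEQ_metric)
qed

lemma borel_measurable_indicator_scaleR:
  fixes g :: "'s \<Rightarrow> 'a::{banach, second_countable_topology}"
  shows "integrable M g \<Longrightarrow> A \<in> sets M \<Longrightarrow> (\<lambda>s. indicat_real A s *\<^sub>R g s) \<in> borel_measurable M"
  by (intro borel_measurable_integrable integrable_mult_indicator)

text \<open>The indicators of \<open>{0..X n}\<close> converge to that of \<open>{0..t}\<close> at every point except possibly \<open>t\<close>,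
  so dominated convergence applies.\<close>

lemma continuous_on_indefinite_set_integral:
  fixes g :: "real \<Rightarrow> 'a::euclidean_space"
  assumes g: "integrable lebesgue g"
  shows "continuous_on UNIV (\<lambda>t. LINT s:{0..t}|lebesgue. g s)"
  unfolding continuous_on_sequentially
proof (intro allI impI ballI)
  fix X :: "nat \<Rightarrow> real" and t assume "(\<forall>n. X n \<in> UNIV) \<and> X \<longlonglongrightarrow> t"
  then have X: "X \<longlonglongrightarrow> t" by simp
  have "(\<lambda>n. LINT s:{0..X n}|lebesgue. g s) \<longlonglongrightarrow> (LINT s:{0..t}|lebesgue. g s)"
    unfolding set_lebesgue_integral_def
  proof (rule integral_dominated_convergence[where w = "\<lambda>s. norm (g s)"])
    show "AE s in lebesgue. (\<lambda>n. indicat_real {0..X n} s *\<^sub>R g s)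
            \<longlonglongrightarrow> indicat_real {0..t} s *\<^sub>R g s"
    proof (rule AE_I[where N = "{t}"])
      show "{s \<in> space lebesgue. \<not> (\<lambda>n. indicat_real {0..X n} s *\<^sub>R g s)
            \<longlonglongrightarrow> indicat_real {0..t} s *\<^sub>R g s} \<subseteq> {t}"
      proof clarsimp
        fix s assume ne: "\<not> (\<lambda>n. indicat_real {0..X n} s *\<^sub>R g s)
            \<longlonglongrightarrow> indicat_real {0..t} s *\<^sub>R g s"
        show "s = t"
        proof (rule ccontr)
          assume "s \<noteq> t"
          then have "\<forall>\<^sub>F n in sequentially. (X n < s) = (t < s)"
          proof (cases "s < t")
            case True
            show ?thesis
              using order_tendstoD(1)[OF X True] by eventually_elim (use True in auto)
          next
            case False
            with \<open>s \<noteq> t\<close> have "t < s" by simp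
            show ?thesis
              using order_tendstoD(2)[OF X \<open>t < s\<close>] by eventually_elim (use \<open>t < s\<close> in auto)
          qed
          then have "\<forall>\<^sub>F n in sequentially.
              indicat_real {0..X n} s *\<^sub>R g s = indicat_real {0..t} s *\<^sub>R g s"
            by eventually_elim (auto simp: indicator_def)
          from tendsto_eventually[OF this] ne show False by simp
        qed
      qed
    qed auto
    show "integrable lebesgue (\<lambda>s. norm (g s))" using g by simp
    show "AE s in lebesgue. norm (indicat_real {0..X n} s *\<^sub>R g s) \<le> norm (g s)" for n
      by (auto simp: indicator_def)
  qed (use g in \<open>auto intro!: borel_measurable_indicator_scaleR\<close>)
  then show "((\<lambda>t. LINT s:{0..t}|lebesgue. g s) \<circ> X) \<longlonglongrightarrow> (LINT s:{0..t}|lebesgue. g s)"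
    by (simp add: o_def)
qed

lemma tendsto_indefinite_set_integral_at_top:
  fixes g :: "real \<Rightarrow> 'a::euclidean_space"
  assumes g: "integrable lebesgue g"
  shows "((\<lambda>t. LINT s:{0..t}|lebesgue. g s) \<longlongrightarrow> (LINT s:{0..}|lebesgue. g s)) at_top"
  unfolding set_lebesgue_integral_def
proof (rule integral_dominated_convergence_at_top[where w = "\<lambda>s. norm (g s)"])
  show "AE s in lebesgue. ((\<lambda>t. indicat_real {0..t} s *\<^sub>R g s)
            \<longlongrightarrow> indicat_real {0..} s *\<^sub>R g s) at_top"
  proof (rule AE_I2)
    fix s :: real
    have "\<forall>\<^sub>F t in at_top. indicat_real {0..t} s *\<^sub>R g s = indicat_real {0..} s *\<^sub>R g s"
      using eventually_ge_at_top[of s] by eventually_elim (auto simp: indicator_def)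
    then show "((\<lambda>t. indicat_real {0..t} s *\<^sub>R g s)
            \<longlongrightarrow> indicat_real {0..} s *\<^sub>R g s) at_top"
      by (rule tendsto_eventually)
  qed
  show "integrable lebesgue (\<lambda>s. norm (g s))" using g by simp
  show "\<forall>\<^sub>F t in at_top. AE s in lebesgue. norm (indicat_real {0..t} s *\<^sub>R g s) \<le> norm (g s)"
    by (auto simp: indicator_def)
qed (use g in \<open>auto intro!: borel_measurable_indicator_scaleR\<close>)

lemma set_integrable_of_integrable:
  "integrable M g \<Longrightarrow> A \<in> sets M \<Longrightarrow> set_integrable M A g"
  for g :: "'s \<Rightarrow> 'a::{banach, second_countable_topology}"
  unfolding set_integrable_def by (rule integrable_mult_indicator)

text \<open>Applied to \<open>A = {0..s}\<close> and \<open>B = {0..t}\<close>, this makes the indefinite integral of the dominating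
  function \<open>m\<close> a common modulus of continuity for all indefinite integrals of functions below \<open>m\<close>.\<close>

lemma norm_set_integral_diff_le:
  fixes g :: "'s \<Rightarrow> 'a::{banach, second_countable_topology}"
  assumes g: "integrable M g" and m: "integrable M m"
    and le: "\<And>s. norm (g s) \<le> m s"
    and sets: "A \<in> sets M" "B \<in> sets M" and AB: "A \<subseteq> B"
  shows "norm ((LINT s:B|M. g s) - (LINT s:A|M. g s)) \<le> (LINT s:B|M. m s) - (LINT s:A|M. m s)"
proof -
  have diff: "(LINT s:B|M. h s) - (LINT s:A|M. h s) = (LINT s:B - A|M. h s)"
    if "integrable M h" for h :: "'s \<Rightarrow> 'c::{banach, second_countable_topology}"
  proof -
    have "(LINT s:A \<union> (B - A)|M. h s) = (LINT s:A|M. h s) + (LINT s:B - A|M. h s)"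
      using sets that by (intro set_integral_Un set_integrable_of_integrable) auto
    then show ?thesis using AB by (simp add: Un_absorb1)
  qed
  have "norm (LINT s:B - A|M. g s) \<le> (LINT s:B - A|M. norm (g s))"
    using sets g by (intro set_integral_norm_bound set_integrable_of_integrable) auto
  also have "\<dots> \<le> (LINT s:B - A|M. m s)"
    using sets g m le by (intro set_integral_mono set_integrable_of_integrable) auto
  finally show ?thesis by (simp add: diff g m)
qed

lemma norm_set_integral_le:
  fixes g :: "'s \<Rightarrow> 'a::{banach, second_countable_topology}"
  assumes g: "integrable M g" and m: "integrable M m"
    and le: "\<And>s. norm (g s) \<le> m s" and A: "A \<in> sets M"
  shows "norm (LINT s:A|M. g s) \<le> (LINT s|M. m s)"
proof -
  have "norm (LINT s:A|M. g s) \<le> (LINT s:A|M. m s)"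
    using norm_set_integral_diff_le[OF g m le _ A, of "{}"]
    by (simp add: set_lebesgue_integral_def)
  also have "\<dots> \<le> (LINT s|M. m s)"
    unfolding set_lebesgue_integral_def
    using m A order_trans[OF norm_ge_zero le]
    by (intro integral_mono integrable_mult_indicator) (auto simp: indicator_def)
  finally show ?thesis .
qed

text \<open>The quantitative form of the absolute continuity of the integral: up to \<open>\<epsilon>\<close>, an integrable
  function is bounded.\<close>

lemma integrable_truncation_small:
  fixes g :: "'s \<Rightarrow> real"
  assumes g: "integrable M g" and "\<epsilon> > 0"
  obtains N :: real where "N > 0" "(LINT s|M. max 0 (\<bar>g s\<bar> - N)) < \<epsilon>"
proof -
  have "(\<lambda>n. LINT s|M. max 0 (\<bar>g s\<bar> - real n)) \<longlonglongrightarrow> (LINT s|M. 0)"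
  proof (rule integral_dominated_convergence[where w = "\<lambda>s. \<bar>g s\<bar>"])
    show "AE s in M. (\<lambda>n. max 0 (\<bar>g s\<bar> - real n)) \<longlonglongrightarrow> 0"
    proof (rule AE_I2)
      fix s
      have "\<forall>\<^sub>F n in sequentially. \<bar>g s\<bar> \<le> real n"
        using filterlim_real_sequentially by (simp add: filterlim_at_top)
      then have "\<forall>\<^sub>F n in sequentially. max 0 (\<bar>g s\<bar> - real n) = 0"
        by eventually_elim auto
      then show "(\<lambda>n. max 0 (\<bar>g s\<bar> - real n)) \<longlonglongrightarrow> 0"
        by (rule tendsto_eventually)
    qed
  qed (use g in auto)
  then have "\<forall>\<^sub>F n in sequentially. (LINT s|M. max 0 (\<bar>g s\<bar> - real n)) < \<epsilon>"
    using \<open>\<epsilon> > 0\<close> by (intro order_tendstoD(2)) auto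
  then have "\<forall>\<^sub>F n in sequentially. 0 < n \<and> (LINT s|M. max 0 (\<bar>g s\<bar> - real n)) < \<epsilon>"
    using eventually_gt_at_top[of 0] by eventually_elim auto
  then obtain n :: nat where "0 < n" "(LINT s|M. max 0 (\<bar>g s\<bar> - real n)) < \<epsilon>"
    by (auto dest: eventually_happens)
  then show thesis by (intro that[of "real n"]) auto
qed

text \<open>Split \<open>\<bar>g\<bar> \<le> N + r\<close> with \<open>r\<close> of integral below \<open>\<epsilon> / 2\<close>. Over disjoint intervals the part \<open>r\<close>
  contributes at most its whole integral, and the bounded part at most \<open>N\<close> times their total length.\<close>

lemma locally_abs_cont_indefinite_integral:
  fixes g :: "real \<Rightarrow> real"
  assumes g: "integrable lebesgue g"
  shows "locally_abs_cont (\<lambda>t. a + (LINT s:{0..t}|lebesgue. g s))"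
  unfolding locally_abs_cont_def abs_cont_on_def
proof (intro allI impI)
  fix b \<epsilon> :: real assume "0 < b" "0 < \<epsilon>"
  let ?G = "\<lambda>t. a + (LINT s:{0..t}|lebesgue. g s)"
  obtain N where N: "N > 0" "(LINT s|lebesgue. max 0 (\<bar>g s\<bar> - N)) < \<epsilon> / 2"
    using integrable_truncation_small[OF g, of "\<epsilon> / 2"] \<open>0 < \<epsilon>\<close> by auto
  define r where "r s = max 0 (\<bar>g s\<bar> - N)" for s
  have r: "integrable lebesgue r" "\<And>s. 0 \<le> r s"
  proof -
    show "integrable lebesgue r"
      by (rule Bochner_Integration.integrable_bound[OF integrable_abs[OF g]])
         (use borel_measurable_integrable[OF g] N in \<open>auto simp: r_def[abs_def]\<close>)
  qed (simp add: r_def)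
  have incr: "\<bar>?G v - ?G u\<bar> \<le> (LINT s|lebesgue. indicator {u<..<v} s * r s) + N * (v - u)"
    if "0 \<le> u" "u \<le> v" for u v
  proof -
    have eq: "?G v - ?G u = (LINT s:{u<..v}|lebesgue. g s)"
    proof -
      have "{0..v} = {0..u} \<union> {u<..v}" using that by auto
      moreover have "(LINT s:{0..u} \<union> {u<..v}|lebesgue. g s)
          = (LINT s:{0..u}|lebesgue. g s) + (LINT s:{u<..v}|lebesgue. g s)"
        using g by (intro set_integral_Un set_integrable_of_integrable) auto
      ultimately show ?thesis by simp
    qed
    also have "\<dots> = (LINT s:{u<..<v}|lebesgue. g s)"
      unfolding set_lebesgue_integral_def
    proof (rule integral_cong_AE)
      show "AE s in lebesgue. indicat_real {u<..v} s *\<^sub>R g s = indicat_real {u<..<v} s *\<^sub>R g s"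
        by (rule AE_I[where N = "{v}"]) (auto simp: indicator_def)
    qed (use g in \<open>auto intro!: borel_measurable_indicator_scaleR simp del: real_scaleR_def\<close>)
    finally have "\<bar>?G v - ?G u\<bar> \<le> (LINT s:{u<..<v}|lebesgue. \<bar>g s\<bar>)"
      using set_integral_norm_bound[OF set_integrable_of_integrable[OF g], of "{u<..<v}"] by simp
    have const: "set_integrable lebesgue {u<..<v} (\<lambda>s. N)"
      using that by (simp add: set_integrable_def integrable_indicator_iff)
    note \<open>\<bar>?G v - ?G u\<bar> \<le> (LINT s:{u<..<v}|lebesgue. \<bar>g s\<bar>)\<close>
    also have "(LINT s:{u<..<v}|lebesgue. \<bar>g s\<bar>) \<le> (LINT s:{u<..<v}|lebesgue. r s + N)"
    proof (rule set_integral_mono)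
      show "set_integrable lebesgue {u<..<v} (\<lambda>s. r s + N)"
        by (intro set_integral_add const set_integrable_of_integrable r) auto
    qed (use g in \<open>auto simp: r_def intro!: set_integrable_of_integrable\<close>)
    also have "\<dots> = (LINT s:{u<..<v}|lebesgue. r s) + (LINT s:{u<..<v}|lebesgue. N)"
      by (intro set_integral_add const set_integrable_of_integrable r) auto
    also have "(LINT s:{u<..<v}|lebesgue. N) = N * (v - u)"
      using that by (simp add: set_lebesgue_integral_def)
    finally show ?thesis by (simp add: set_lebesgue_integral_def)
  qed
  show "\<exists>\<delta>>0. \<forall>(n::nat) u v.
        (\<forall>i<n. 0 \<le> u i \<and> u i \<le> v i \<and> v i \<le> b) \<longrightarrow>
        (\<forall>i<n. \<forall>j<n. i \<noteq> j \<longrightarrow> {u i<..<v i} \<inter> {u j<..<v j} = {}) \<longrightarrow>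
        (\<Sum>i<n. v i - u i) < \<delta> \<longrightarrow> (\<Sum>i<n. \<bar>?G (v i) - ?G (u i)\<bar>) < \<epsilon>"
  proof (intro exI[of _ "\<epsilon> / (2 * N)"] conjI allI impI)
    show "0 < \<epsilon> / (2 * N)" using N \<open>0 < \<epsilon>\<close> by simp
    fix n :: nat and u v :: "nat \<Rightarrow> real"
    assume uv: "\<forall>i<n. 0 \<le> u i \<and> u i \<le> v i \<and> v i \<le> b"
      and disj: "\<forall>i<n. \<forall>j<n. i \<noteq> j \<longrightarrow> {u i<..<v i} \<inter> {u j<..<v j} = {}"
      and small: "(\<Sum>i<n. v i - u i) < \<epsilon> / (2 * N)"
    have rI: "integrable lebesgue (\<lambda>s. indicator {u i<..<v i} s * r s)" for i
      using integrable_mult_indicator[of "{u i<..<v i}" lebesgue r] r by simp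
    have ind: "(\<Sum>i<n. indicat_real {u i<..<v i} s) \<le> 1" for s
    proof -
      have "(\<Sum>i<n. indicat_real {u i<..<v i} s) = indicator (\<Union>i<n. {u i<..<v i}) s"
        by (rule indicator_UN_disjoint[symmetric])
           (use disj in \<open>auto simp: disjoint_family_on_def\<close>)
      also have "\<dots> \<le> 1" by (simp add: indicator_def)
      finally show ?thesis .
    qed
    have "(\<Sum>i<n. \<bar>?G (v i) - ?G (u i)\<bar>)
        \<le> (\<Sum>i<n. (LINT s|lebesgue. indicator {u i<..<v i} s * r s) + N * (v i - u i))"
      using uv by (intro sum_mono incr) auto
    also have "\<dots> = (LINT s|lebesgue. (\<Sum>i<n. indicator {u i<..<v i} s * r s))
        + N * (\<Sum>i<n. v i - u i)"
      using Bochner_Integration.integral_sum[of "{..<n}" lebesgue, OF rI]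
      by (simp add: sum.distrib sum_distrib_left)
    also have "(LINT s|lebesgue. (\<Sum>i<n. indicator {u i<..<v i} s * r s)) \<le> (LINT s|lebesgue. r s)"
    proof (rule integral_mono)
      show "integrable lebesgue (\<lambda>s. \<Sum>i<n. indicator {u i<..<v i} s * r s)"
        by (intro Bochner_Integration.integrable_sum rI)
      show "(\<Sum>i<n. indicator {u i<..<v i} s * r s) \<le> r s" for s
        unfolding sum_distrib_right[symmetric]
        using mult_right_mono[OF ind[of s] r(2)[of s]] by simp
    qed (rule r)
    also have "(LINT s|lebesgue. r s) < \<epsilon> / 2"
      using N by (simp add: r_def)
    also have "N * (\<Sum>i<n. v i - u i) < \<epsilon> / 2"
      using small N by (simp add: field_simps)
    finally show "(\<Sum>i<n. \<bar>?G (v i) - ?G (u i)\<bar>) < \<epsilon>" by simp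
  qed
qed

text \<open>Lebesgue differentiation from the right, where the averages are taken over \<open>{t..t + h}\<close>. The
  other side follows by reflection.\<close>

lemma AE_one_sided_difference_quotient:
  fixes g :: "real \<Rightarrow> real"
  assumes g: "\<And>a b. g integrable_on {a..b}"
  shows "AE t in lebesgue. ((\<lambda>h. integral {t..t + h} g / h) \<longlongrightarrow> g t) (at_right 0)"
proof -
  obtain N where N: "negligible N"
     "\<And>x e. \<lbrakk>x \<notin> N; 0 < e\<rbrakk> \<Longrightarrow> \<exists>d>0. \<forall>h. 0 < h \<and> h < d \<longrightarrow>
        norm (integral (cbox x (x + h *\<^sub>R One)) g /\<^sub>R h ^ DIM(real) - g x) < e"
    by (rule integrable_ccontinuous_explicit[of g]) (use g in auto)
  have lim: "((\<lambda>h. integral {t..t + h} g / h) \<longlongrightarrow> g t) (at_right 0)" if "t \<notin> N" for t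
  proof (rule tendstoI)
    fix e :: real assume "0 < e"
    with N(2)[OF that] obtain d where "d > 0" and d: "\<forall>h. 0 < h \<and> h < d \<longrightarrow>
        norm (integral (cbox t (t + h *\<^sub>R One)) g /\<^sub>R h ^ DIM(real) - g t) < e"
      by blast
    then show "\<forall>\<^sub>F h in at_right 0. dist (integral {t..t + h} g / h) (g t) < e"
      unfolding eventually_at_right_field
      using \<open>d > 0\<close> by (intro exI[of _ d]) (auto simp: dist_norm divide_inverse mult.commute)
  qed
  have "N \<in> null_sets lebesgue" using N(1) by (simp add: negligible_iff_null_sets)
  then show ?thesis
    by (rule AE_I') (use lim in blast)
qed

lemma AE_lebesgue_reflect:
  assumes "AE t in lebesgue. P t" shows "AE t::real in lebesgue. P (- t)"
proof -
  obtain N where N: "N \<in> null_sets lebesgue" "{t. \<not> P t} \<subseteq> N"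
    using assms by (auto simp: eventually_ae_filter)
  have "negligible (uminus ` N)"
    using N(1) by (intro negligible_differentiable_image_negligible)
      (simp_all add: negligible_iff_null_sets differentiable_on_minus)
  then have "uminus ` N \<in> null_sets lebesgue"
    by (simp add: negligible_iff_null_sets)
  moreover have "{t \<in> space lebesgue. \<not> P (- t)} \<subseteq> uminus ` N"
  proof
    fix t assume "t \<in> {t \<in> space lebesgue. \<not> P (- t)}"
    then have "- t \<in> N" using N(2) by auto
    then show "t \<in> uminus ` N" by (rule rev_image_eqI) simp
  qed
  ultimately show ?thesis by (rule AE_I')
qed

text \<open>Lebesgue's differentiation theorem. The left difference quotient of the integral of \<open>g\<close> at \<open>t\<close> is the
  right one of the integral of \<open>\<lambda>s. g (- s)\<close> at \<open>- t\<close>.\<close>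

lemma AE_has_derivative_indefinite_integral:
  fixes g :: "real \<Rightarrow> real"
  assumes g: "integrable lebesgue g"
  shows "AE t in lebesgue. 0 < t \<longrightarrow>
    ((\<lambda>t. LINT s:{0..t}|lebesgue. g s) has_real_derivative g t) (at t)"
proof -
  let ?F = "\<lambda>t. LINT s:{0..t}|lebesgue. g s"
  have int: "g integrable_on {a..b}" "integral {a..b} g = ?F b - ?F a" if "0 \<le> a" "a \<le> b" for a b
  proof -
    have si: "set_integrable lebesgue {c..d} g" for c d
      using g by (intro set_integrable_of_integrable) auto
    have F: "?F d = integral {0..d} g" for d
      by (rule set_lebesgue_integral_eq_integral(2)[OF si])
    have i: "g integrable_on {c..d}" for c d
      by (rule set_lebesgue_integral_eq_integral(1)[OF si])
    show "g integrable_on {a..b}" by (rule i)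
    show "integral {a..b} g = ?F b - ?F a"
      using Henstock_Kurzweil_Integration.integral_combine[OF that i] by (simp add: F)
  qed
  have i: "g integrable_on {a..b}" for a b
    using g by (intro set_lebesgue_integral_eq_integral(1) set_integrable_of_integrable) auto
  have "(\<lambda>s. g (- s)) integrable_on {a..b}" for a b
    using i[of "-b" "-a"] Henstock_Kurzweil_Integration.integrable_reflect_real[where f = g and a = "-b" and b = "-a"] by simp
  then have "AE t in lebesgue.
      ((\<lambda>h. integral {t..t + h} (\<lambda>s. g (- s)) / h) \<longlongrightarrow> g (- t)) (at_right 0)"
    by (rule AE_one_sided_difference_quotient)
  from AE_lebesgue_reflect[OF this] AE_one_sided_difference_quotient[OF i]
  show ?thesis
  proof eventually_elim
    case (elim t)
    show ?case
    proof
      assume "0 < t"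
      have "((\<lambda>h. (?F (t + h) - ?F t) / h) \<longlongrightarrow> g t) (at_right 0)"
      proof (rule Lim_transform_eventually[OF elim(2)])
        show "\<forall>\<^sub>F h in at_right 0. integral {t..t + h} g / h = (?F (t + h) - ?F t) / h"
          using eventually_at_right_less
          by eventually_elim (use \<open>0 < t\<close> int in simp)
      qed
      moreover have "((\<lambda>h. (?F (t + - h) - ?F t) / - h) \<longlongrightarrow> g t) (at_right 0)"
      proof (rule Lim_transform_eventually)
        show "((\<lambda>h. integral {- t..- t + h} (\<lambda>s. g (- s)) / h) \<longlongrightarrow> g t) (at_right 0)"
          using elim(1) by simp
        have "\<forall>\<^sub>F h in at_right 0. 0 < h \<and> h < t"
          using \<open>0 < t\<close> by (simp add: eventually_at_right_field) blast
        then show "\<forall>\<^sub>F h in at_right 0.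
            integral {- t..- t + h} (\<lambda>s. g (- s)) / h = (?F (t + - h) - ?F t) / - h"
        proof eventually_elim
          case (elim h)
          then have "integral {- t..- t + h} (\<lambda>s. g (- s)) = ?F t - ?F (t - h)"
            using Henstock_Kurzweil_Integration.integral_reflect_real[where f = g and a = "t - h" and b = t] int(2)[of "t - h" t]
            by simp
          then show ?case by (simp add: divide_simps)
        qed
      qed
      ultimately show "(?F has_real_derivative g t) (at t)"
        unfolding DERIV_def filterlim_at_split by (simp add: filterlim_at_left_to_right)
    qed
  qed
qed

section \<open>Caratheodory systems with an integrable bound\<close>

lemma continuous_on_UNIV_measurable_lebesgue:
  fixes u :: "real \<Rightarrow> 'a::euclidean_space"
  assumes "continuous_on UNIV u" shows "u \<in> borel_measurable lebesgue"
  using borel_measurable_continuous_onI[OF assms] by (simp add: measurable_completion)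

text \<open>The field is asked to be continuous and bounded at every time rather than almost every time; a field
  on the half-line is brought into this form by setting it to zero at negative times and on a null set.\<close>

locale bounded_caratheodory =
  fixes H :: "real \<Rightarrow> 'a::euclidean_space \<Rightarrow> 'a" and m :: "real \<Rightarrow> real"
  assumes meas: "\<And>z. (\<lambda>t. H t z) \<in> borel_measurable lebesgue"
    and cont: "\<And>t. continuous_on UNIV (H t)"
    and bound: "\<And>t z. norm (H t z) \<le> m t"
    and m: "integrable lebesgue m"
begin

definition picard :: "'a \<Rightarrow> (real \<Rightarrow> 'a) \<Rightarrow> real \<Rightarrow> 'a" where
  "picard z u t = z + (LINT s:{0..t}|lebesgue. H s (u s))"

definition picard_end :: "'a \<Rightarrow> (real \<Rightarrow> 'a) \<Rightarrow> 'a" where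
  "picard_end z u = z + (LINT s:{0..}|lebesgue. H s (u s))"

definition modulus :: "real \<Rightarrow> real" where
  "modulus t = (LINT s:{0..t}|lebesgue. m s)"

lemma integrable_comp:
  assumes "u \<in> borel_measurable lebesgue"
  shows "integrable lebesgue (\<lambda>s. H s (u s))"
proof (rule Bochner_Integration.integrable_bound[OF m])
  show "(\<lambda>s. H s (u s)) \<in> borel_measurable lebesgue"
    by (rule borel_measurable_caratheodory_comp[of H lebesgue u, OF meas cont assms])
  show "AE s in lebesgue. norm (H s (u s)) \<le> norm (m s)"
    by (intro AE_I2 order_trans[OF bound]) simp
qed

lemma continuous_modulus: "continuous_on UNIV modulus"
  unfolding modulus_def[abs_def] by (rule continuous_on_indefinite_set_integral[OF m])

lemma continuous_picard:
  "u \<in> borel_measurable lebesgue \<Longrightarrow> continuous_on UNIV (picard z u)"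
  unfolding picard_def[abs_def]
  by (rule continuous_on_add[OF continuous_on_const
        continuous_on_indefinite_set_integral[OF integrable_comp]])

lemma picard_diff_le:
  assumes "u \<in> borel_measurable lebesgue"
  shows "norm (picard z u t - picard z u s) \<le> \<bar>modulus t - modulus s\<bar>"
proof -
  have le: "norm (picard z u t - picard z u s) \<le> modulus t - modulus s" if "s \<le> t" for s t
    using norm_set_integral_diff_le[OF integrable_comp[OF assms] m bound, of "{0..s}" "{0..t}"] that
    by (simp add: picard_def modulus_def)
  show ?thesis
  proof (cases "s \<le> t")
    case True then show ?thesis using le[OF True] by simp
  next
    case False then show ?thesis using le[of t s] by (simp add: norm_minus_commute)
  qed
qed

lemma picard_start:
  assumes "t \<le> 0" shows "picard z u t = z"
proof -
  have "(LINT s:{0..t}|lebesgue. H s (u s)) = 0"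
    unfolding set_lebesgue_integral_def
  proof (rule integral_eq_zero_AE)
    show "AE s in lebesgue. indicat_real {0..t} s *\<^sub>R H s (u s) = 0"
      by (rule AE_I[where N = "{0}"]) (use assms in \<open>auto simp: indicator_def\<close>)
  qed
  then show ?thesis by (simp add: picard_def)
qed

lemma picard_minus_start_le:
  assumes "u \<in> borel_measurable lebesgue"
  shows "norm (picard z u t - z) \<le> (LINT s|lebesgue. m s)"
  using norm_set_integral_le[OF integrable_comp[OF assms] m bound, of "{0..t}"]
  by (simp add: picard_def)

lemma set_integral_comp_tendsto:
  assumes A: "A \<in> sets lebesgue"
    and u: "\<And>n. u n \<in> borel_measurable lebesgue" "v \<in> borel_measurable lebesgue"
    and lim: "\<And>s. s \<in> A \<Longrightarrow> (\<lambda>n. u n s) \<longlonglongrightarrow> v s"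
  shows "(\<lambda>n. LINT s:A|lebesgue. H s (u n s)) \<longlonglongrightarrow> (LINT s:A|lebesgue. H s (v s))"
  unfolding set_lebesgue_integral_def
proof (rule integral_dominated_convergence[OF _ _ m])
  show "AE s in lebesgue. (\<lambda>n. indicat_real A s *\<^sub>R H s (u n s)) \<longlonglongrightarrow> indicat_real A s *\<^sub>R H s (v s)"
  proof (rule AE_I2)
    fix s
    show "(\<lambda>n. indicat_real A s *\<^sub>R H s (u n s)) \<longlonglongrightarrow> indicat_real A s *\<^sub>R H s (v s)"
    proof (cases "s \<in> A")
      case True
      then show ?thesis
        using continuous_on_tendsto_compose[OF cont[of s] lim[OF True]] by simp
    qed simp
  qed
  show "AE s in lebesgue. norm (indicat_real A s *\<^sub>R H s (u n s)) \<le> m s" for n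
    using bound[of s "u n s" for s] order_trans[OF norm_ge_zero bound] by (auto simp: indicator_def)
  show "(\<lambda>s. indicat_real A s *\<^sub>R H s (v s)) \<in> borel_measurable lebesgue"
    by (rule borel_measurable_indicator_scaleR[OF integrable_comp[OF u(2)] A])
  show "(\<lambda>s. indicat_real A s *\<^sub>R H s (u n s)) \<in> borel_measurable lebesgue" for n
    by (rule borel_measurable_indicator_scaleR[OF integrable_comp[OF u(1)] A])
qed

text \<open>The iterates of the delayed Picard operator, started from the constant \<open>z\<close>. No separate history
  function is required: for \<open>t \<le> 0\<close> the integral in \<open>picard\<close> vanishes, so every iterate has the value
  \<open>z\<close> there.\<close>

primrec tonelli :: "real \<Rightarrow> 'a \<Rightarrow> nat \<Rightarrow> real \<Rightarrow> 'a" where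
  "tonelli \<delta> z 0 = (\<lambda>t. z)"
| "tonelli \<delta> z (Suc j) = picard z (\<lambda>s. tonelli \<delta> z j (s - \<delta>))"

lemma continuous_on_delay:
  fixes u :: "real \<Rightarrow> 'a"
  shows "continuous_on UNIV u \<Longrightarrow> continuous_on UNIV (\<lambda>s. u (s - \<delta>))"
  by (rule continuous_on_compose2[of UNIV u UNIV "\<lambda>s. s - \<delta>"])
     (simp_all add: continuous_on_diff)

lemma continuous_tonelli: "continuous_on UNIV (tonelli \<delta> z j)"
proof (induction j)
  case (Suc j)
  show ?case
    unfolding tonelli.simps
    by (rule continuous_picard, rule continuous_on_UNIV_measurable_lebesgue,
        rule continuous_on_delay[OF Suc.IH])
qed simp

lemma continuous_tonelli_delay: "continuous_on UNIV (\<lambda>s. tonelli \<delta> z j (s - \<delta>'))"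
  by (rule continuous_on_delay[OF continuous_tonelli])

lemmas measurable_tonelli_delay =
  continuous_on_UNIV_measurable_lebesgue[OF continuous_tonelli_delay]

text \<open>The delay makes an iterate on \<open>{..(j + 1) \<delta>}\<close> depend only on the preceding one on \<open>{..j \<delta>}\<close>. Hence the
  \<open>j\<close>-th iterate solves the delayed equation exactly up to time \<open>j \<delta>\<close>.\<close>

lemma tonelli_stable:
  "t \<le> real j * \<delta> \<Longrightarrow> tonelli \<delta> z (Suc j) t = tonelli \<delta> z j t"
proof (induction j arbitrary: t)
  case 0
  then show ?case by (simp add: picard_start)
next
  case (Suc j)
  have "tonelli \<delta> z (Suc j) (s - \<delta>) = tonelli \<delta> z j (s - \<delta>)" if "s \<le> t" for s
    using Suc.prems that by (intro Suc.IH) (simp add: algebra_simps)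
  then have *: "indicat_real {0..t} s *\<^sub>R H s (tonelli \<delta> z (Suc j) (s - \<delta>))
      = indicat_real {0..t} s *\<^sub>R H s (tonelli \<delta> z j (s - \<delta>))" for s
    by (auto simp: indicator_def simp del: tonelli.simps)
  have "picard z (\<lambda>s. tonelli \<delta> z (Suc j) (s - \<delta>)) t = picard z (\<lambda>s. tonelli \<delta> z j (s - \<delta>)) t"
    by (simp only: picard_def set_lebesgue_integral_def *)
  then show ?case by (simp only: tonelli.simps(2))
qed

text \<open>Continuity in the initial value passes through one integration by dominated convergence. For the
  equation without delay it may fail, since solutions need not be unique.\<close>

lemma tonelli_tendsto:
  assumes z: "z \<longlonglongrightarrow> z0"
  shows "(\<lambda>n. tonelli \<delta> (z n) j t) \<longlonglongrightarrow> tonelli \<delta> z0 j t"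
proof (induction j arbitrary: t)
  case (Suc j)
  have "(\<lambda>n. LINT s:{0..t}|lebesgue. H s (tonelli \<delta> (z n) j (s - \<delta>)))
      \<longlonglongrightarrow> (LINT s:{0..t}|lebesgue. H s (tonelli \<delta> z0 j (s - \<delta>)))"
    by (rule set_integral_comp_tendsto[OF _ measurable_tonelli_delay measurable_tonelli_delay Suc.IH])
       simp
  from tendsto_add[OF z this] show ?case by (simp add: picard_def)
qed (use z in simp)

lemma picard_end_tonelli_tendsto:
  assumes z: "z \<longlonglongrightarrow> z0"
  shows "(\<lambda>n. picard_end (z n) (\<lambda>s. tonelli \<delta> (z n) j (s - \<delta>)))
    \<longlonglongrightarrow> picard_end z0 (\<lambda>s. tonelli \<delta> z0 j (s - \<delta>))"
proof -
  have "(\<lambda>n. LINT s:{0..}|lebesgue. H s (tonelli \<delta> (z n) j (s - \<delta>)))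
      \<longlonglongrightarrow> (LINT s:{0..}|lebesgue. H s (tonelli \<delta> z0 j (s - \<delta>)))"
    by (rule set_integral_comp_tendsto[OF _ measurable_tonelli_delay measurable_tonelli_delay
          tonelli_tendsto[OF z]]) simp
  from tendsto_add[OF z this] show ?thesis by (simp add: picard_end_def)
qed

text \<open>A version of Peano's theorem on the half-line. The delayed solutions are bounded and have the common
  modulus of continuity \<open>modulus\<close>; convergence of a subsequence at all rational times therefore
  extends to all times. The horizons \<open>j \<delta>\<close>, up to which the iterates solve the delayed equation,
  have to exhaust the half-line for the limit to solve the equation everywhere.\<close>

lemma tonelli_limit:
  fixes z :: "nat \<Rightarrow> 'a" and \<delta> :: "nat \<Rightarrow> real"
  assumes z: "bounded (range z)"
    and \<delta>: "\<delta> \<longlonglongrightarrow> 0" "\<And>n. 0 \<le> \<delta> n"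
    and j: "filterlim (\<lambda>n. real (j n) * \<delta> n) at_top sequentially"
  obtains r z0 y where "strict_mono (r :: nat \<Rightarrow> nat)" "(\<lambda>n. z (r n)) \<longlonglongrightarrow> z0"
    "continuous_on UNIV y" "y = picard z0 y"
    "(\<lambda>n. picard_end (z (r n)) (\<lambda>s. tonelli (\<delta> (r n)) (z (r n)) (j (r n)) (s - \<delta> (r n))))
       \<longlonglongrightarrow> picard_end z0 y"
proof -
  define u where "u n s = tonelli (\<delta> n) (z n) (j n) (s - \<delta> n)" for n s
  define Y where "Y n = tonelli (\<delta> n) (z n) (Suc (j n))" for n
  have Y: "Y n = picard (z n) (u n)" for n by (simp add: Y_def u_def[abs_def])
  have u_cont: "continuous_on UNIV (u n)" for n
    unfolding u_def by (rule continuous_tonelli_delay)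
  note u_meas = continuous_on_UNIV_measurable_lebesgue[OF u_cont]
  have Y_diff: "norm (Y n t - Y n s) \<le> \<bar>modulus t - modulus s\<bar>" for n t s
    unfolding Y by (rule picard_diff_le[OF u_meas])
  obtain B where B: "\<And>n. norm (z n) \<le> B" using z by (auto simp: bounded_iff)
  have "norm (Y n t) \<le> B + (LINT s|lebesgue. m s)" for n t
    using picard_minus_start_le[OF u_meas[of n], of "z n" t] B[of n] norm_triangle_sub[of "Y n t" "z n"]
    by (simp add: Y)
  then obtain r where r: "strict_mono r" and rat: "\<And>q. q \<in> \<rat> \<Longrightarrow> \<exists>l. (\<lambda>n. Y (r n) q) \<longlonglongrightarrow> l"
    using function_convergent_subsequence[of "\<rat> :: real set" Y] countable_rat by metis
  \<comment> \<open>Compare \<open>t\<close> with a rational \<open>q\<close> so close that \<open>modulus\<close> varies by less than \<open>e / 3\<close> between them.\<close>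
  have "convergent (\<lambda>n. Y (r n) t)" for t
  proof (rule Cauchy_convergent, rule CauchyI)
    fix e :: real assume "0 < e"
    then obtain d where d: "0 < d" "\<And>s. dist s t < d \<Longrightarrow> dist (modulus s) (modulus t) < e / 3"
      using continuous_modulus unfolding continuous_on_iff by (metis UNIV_I divide_pos_pos zero_less_numeral)
    obtain q where q: "q \<in> \<rat>" "t < q" "q < t + d"
      using Rats_dense_in_real[of t "t + d"] d by auto
    then have mod_q: "\<bar>modulus t - modulus q\<bar> < e / 3"
      using d(2)[of q] by (auto simp: dist_real_def abs_minus_commute)
    have "Cauchy (\<lambda>n. Y (r n) q)" using rat[OF q(1)] LIMSEQ_imp_Cauchy by blast
    then obtain N where N: "\<And>i k. N \<le> i \<Longrightarrow> N \<le> k \<Longrightarrow> norm (Y (r i) q - Y (r k) q) < e / 3"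
      using \<open>0 < e\<close> CauchyD[of _ "e / 3"] by fastforce
    have "norm (Y (r i) t - Y (r k) t) < e" if "N \<le> i" "N \<le> k" for i k
    proof -
      have "Y (r i) t - Y (r k) t = (Y (r i) t - Y (r i) q) + (Y (r i) q - Y (r k) q) + (Y (r k) q - Y (r k) t)"
        by simp
      also have "norm \<dots> \<le> norm (Y (r i) t - Y (r i) q) + norm (Y (r i) q - Y (r k) q) + norm (Y (r k) q - Y (r k) t)"
        by (intro norm_triangle_mono norm_triangle_ineq order_refl)
      also have "\<dots> < e"
        using N[OF that] Y_diff[of "r i" t q] Y_diff[of "r k" q t] mod_q by linarith
      finally show ?thesis .
    qed
    then show "\<exists>M. \<forall>i\<ge>M. \<forall>k\<ge>M. norm (Y (r i) t - Y (r k) t) < e" by blast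
  qed
  then obtain y where y: "\<And>t. (\<lambda>n. Y (r n) t) \<longlonglongrightarrow> y t"
    unfolding convergent_def by metis
  have y_meas: "y \<in> borel_measurable lebesgue"
  proof (rule borel_measurable_LIMSEQ_metric)
    show "Y (r n) \<in> borel_measurable lebesgue" for n
      unfolding Y_def by (rule continuous_on_UNIV_measurable_lebesgue[OF continuous_tonelli])
  qed (rule y)
  \<comment> \<open>The initial values converge without a further extraction, since \<open>Y n 0 = z n\<close>.\<close>
  have z0: "(\<lambda>n. z (r n)) \<longlonglongrightarrow> y 0"
    using y[of 0] by (simp add: Y picard_start)
  have lim: "(\<lambda>n. u (r n) s) \<longlonglongrightarrow> y s" for s
  proof -
    have d0: "(\<lambda>n. \<delta> (r n)) \<longlonglongrightarrow> 0"
      using LIMSEQ_subseq_LIMSEQ[OF \<delta>(1) r] by (simp add: o_def)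
    have "(\<lambda>n. s - \<delta> (r n)) \<longlonglongrightarrow> s - 0" by (intro tendsto_intros d0)
    then have "(\<lambda>n. modulus (s - \<delta> (r n))) \<longlonglongrightarrow> modulus s"
      using continuous_on_tendsto_compose[OF continuous_modulus, of "\<lambda>n. s - \<delta> (r n)"] by simp
    then have mod_0: "(\<lambda>n. \<bar>modulus (s - \<delta> (r n)) - modulus s\<bar>) \<longlonglongrightarrow> 0"
      by (intro tendsto_rabs_zero) (simp add: LIM_zero)
    have "(\<lambda>n. Y (r n) (s - \<delta> (r n)) - Y (r n) s) \<longlonglongrightarrow> 0"
      by (rule tendsto_0_le[OF mod_0, of _ 1]) (use Y_diff in auto)
    from tendsto_add[OF this y[of s]] have *: "(\<lambda>n. Y (r n) (s - \<delta> (r n))) \<longlonglongrightarrow> y s"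
      by simp
    have "\<forall>\<^sub>F n in sequentially. s \<le> real (j (r n)) * \<delta> (r n)"
      using filterlim_compose[OF j filterlim_subseq[OF r]] by (simp add: filterlim_at_top o_def)
    then have "\<forall>\<^sub>F n in sequentially. Y (r n) (s - \<delta> (r n)) = u (r n) s"
    proof eventually_elim
      case (elim n)
      then show ?case
        unfolding Y_def u_def using \<delta>(2)[of "r n"] by (intro tonelli_stable) linarith
    qed
    with * show ?thesis by (rule Lim_transform_eventually)
  qed
  have y_eq: "y t = picard (y 0) y t" for t
  proof (rule LIMSEQ_unique[OF y])
    show "(\<lambda>n. Y (r n) t) \<longlonglongrightarrow> picard (y 0) y t"
      unfolding Y picard_def
      by (rule tendsto_add[OF z0 set_integral_comp_tendsto[OF _ u_meas y_meas lim]]) simp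
  qed
  show thesis
  proof (rule that[OF r z0])
    show "y = picard (y 0) y" using y_eq by blast
    then show "continuous_on UNIV y" using continuous_picard[OF y_meas] by metis
    show "(\<lambda>n. picard_end (z (r n)) (\<lambda>s. tonelli (\<delta> (r n)) (z (r n)) (j (r n)) (s - \<delta> (r n))))
       \<longlonglongrightarrow> picard_end (y 0) y"
      unfolding picard_end_def u_def[symmetric]
      by (rule tendsto_add[OF z0 set_integral_comp_tendsto[OF _ u_meas y_meas lim]]) simp
  qed
qed

text \<open>The intermediate value theorem is applied to the delayed solutions, which are continuous in the
  parameter of the curve \<open>\<zeta>\<close>. The sign conditions at the ends are asked for all
  functions of the form that the delayed solutions have, so that they can be verified without knowing
  these solutions.\<close>

theorem shooting:
  fixes \<zeta> :: "real \<Rightarrow> 'a" and p :: "'a \<Rightarrow> real"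
  assumes "a \<le> b" and \<zeta>: "continuous_on {a..b} \<zeta>" and p: "continuous_on UNIV p"
    and lo: "\<And>u \<delta>. continuous_on UNIV u \<Longrightarrow> p (picard_end (\<zeta> a) (\<lambda>s. picard (\<zeta> a) u (s - \<delta>))) \<le> c"
    and hi: "\<And>u \<delta>. continuous_on UNIV u \<Longrightarrow> c \<le> p (picard_end (\<zeta> b) (\<lambda>s. picard (\<zeta> b) u (s - \<delta>)))"
  obtains C y where "C \<in> {a..b}" "continuous_on UNIV y" "y = picard (\<zeta> C) y"
    "p (picard_end (\<zeta> C) y) = c"
proof -
  define \<delta> where "\<delta> n = 1 / real (Suc n)" for n
  \<comment> \<open>About \<open>n\<^sup>2\<close> steps of length \<open>1 / n\<close> reach a horizon of about \<open>n\<close>. The number of steps is a successor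
    so that the iterate is itself a Picard image, as the end conditions require.\<close>
  define j where "j n = Suc (Suc n * Suc n)" for n
  define \<phi> where "\<phi> n C = p (picard_end (\<zeta> C) (\<lambda>s. tonelli (\<delta> n) (\<zeta> C) (j n) (s - \<delta> n)))" for n C
  have "continuous_on {a..b} (\<phi> n)" for n
    unfolding continuous_on_sequentially
  proof (intro allI impI ballI)
    fix X C assume "C \<in> {a..b}" and "(\<forall>k. X k \<in> {a..b}) \<and> X \<longlonglongrightarrow> C"
    then have "(\<lambda>k. \<zeta> (X k)) \<longlonglongrightarrow> \<zeta> C"
      using \<zeta> unfolding continuous_on_sequentially by (auto simp: o_def)
    from continuous_on_tendsto_compose[OF p picard_end_tonelli_tendsto[OF this]]
    show "(\<phi> n \<circ> X) \<longlonglongrightarrow> \<phi> n C" by (simp add: \<phi>_def o_def)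
  qed
  moreover have "\<phi> n a \<le> c" "c \<le> \<phi> n b" for n
    unfolding \<phi>_def j_def tonelli.simps
    by (rule lo hi, rule continuous_tonelli_delay)+
  ultimately have "\<exists>C. a \<le> C \<and> C \<le> b \<and> \<phi> n C = c" for n
    using \<open>a \<le> b\<close> by (intro IVT') auto
  then obtain C where C: "\<And>n. C n \<in> {a..b}" "\<And>n. \<phi> n (C n) = c"
    by (metis atLeastAtMost_iff)
  have comp: "compact (\<zeta> ` {a..b})" using \<zeta> by (intro compact_continuous_image) auto
  have "bounded (range (\<lambda>n. \<zeta> (C n)))"
    by (rule bounded_subset[OF compact_imp_bounded[OF comp]]) (use C in auto)
  moreover have "\<delta> \<longlonglongrightarrow> 0"
    unfolding \<delta>_def using LIMSEQ_inverse_real_of_nat by (simp add: inverse_eq_divide)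
  moreover have "0 \<le> \<delta> n" for n by (simp add: \<delta>_def)
  moreover have "filterlim (\<lambda>n. real (j n) * \<delta> n) at_top sequentially"
  proof (rule filterlim_at_top_mono[OF filterlim_real_sequentially])
    show "\<forall>\<^sub>F n in sequentially. real n \<le> real (j n) * \<delta> n"
      by (simp add: j_def \<delta>_def field_simps)
  qed
  ultimately obtain r z0 y where r: "strict_mono r" and z0: "(\<lambda>n. \<zeta> (C (r n))) \<longlonglongrightarrow> z0"
    and y: "continuous_on UNIV y" "y = picard z0 y"
    and lim: "(\<lambda>n. picard_end (\<zeta> (C (r n))) (\<lambda>s. tonelli (\<delta> (r n)) (\<zeta> (C (r n))) (j (r n)) (s - \<delta> (r n))))
       \<longlonglongrightarrow> picard_end z0 y"
    by (rule tonelli_limit) blast+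
  have "z0 \<in> \<zeta> ` {a..b}"
    by (rule closed_sequentially[OF compact_imp_closed[OF comp] _ z0]) (use C in auto)
  then obtain C0 where C0: "C0 \<in> {a..b}" "z0 = \<zeta> C0" by auto
  have "(\<lambda>n. \<phi> (r n) (C (r n))) \<longlonglongrightarrow> p (picard_end z0 y)"
    unfolding \<phi>_def using continuous_on_tendsto_compose[OF p lim] by simp
  then have "p (picard_end z0 y) = c" using C(2) by (simp add: LIMSEQ_const_iff)
  with y C0 show thesis by (intro that) auto
qed

end

section \<open>The half-line problem\<close>

text \<open>The projection onto \<open>{- \<Phi> M..\<Phi> M}\<close> before inverting is what makes \<open>x' = \<theta> w / k\<close> meaningful, and
  bounded by \<open>M / k\<close>, for every real \<open>w\<close>. Monotonicity of \<open>\<theta>\<close> drives the shooting argument.\<close>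

lemma clamped_inverse:
  fixes \<Phi> :: "real \<Rightarrow> real"
  assumes "0 \<le> M" and cont: "continuous_on {-M..M} \<Phi>" and mono: "strict_mono_on {-M..M} \<Phi>"
    and odd: "\<Phi> (- M) = - \<Phi> M"
  obtains \<theta> where "continuous_on UNIV \<theta>" "mono \<theta>" "\<And>w. \<theta> w \<in> {-M..M}"
    "\<And>u. u \<in> {-M..M} \<Longrightarrow> \<theta> (\<Phi> u) = u" "\<And>w. \<bar>w\<bar> \<le> \<Phi> M \<Longrightarrow> \<Phi> (\<theta> w) = w"
proof -
  define L where "L = \<Phi> M"
  define clamp where "clamp w = max (- L) (min L w)" for w
  define \<theta> where "\<theta> w = the_inv_into {-M..M} \<Phi> (clamp w)" for w
  have le: "\<Phi> u \<le> \<Phi> v \<longleftrightarrow> u \<le> v" if "u \<in> {-M..M}" "v \<in> {-M..M}" for u v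
    using strict_mono_on_less_eq[OF mono that] .
  have inj: "inj_on \<Phi> {-M..M}" using mono by (rule strict_mono_on_imp_inj_on)
  have L: "0 \<le> L" using le[of "-M" M] \<open>0 \<le> M\<close> odd by (simp add: L_def)
  have img: "\<Phi> ` {-M..M} = {-L..L}"
  proof
    show "\<Phi> ` {-M..M} \<subseteq> {-L..L}"
      using le[of "-M"] le[of _ M] \<open>0 \<le> M\<close> odd by (auto simp: L_def)
    show "{-L..L} \<subseteq> \<Phi> ` {-M..M}"
    proof
      fix w assume "w \<in> {-L..L}"
      then have "\<exists>u\<ge>-M. u \<le> M \<and> \<Phi> u = w"
        using \<open>0 \<le> M\<close> odd by (intro IVT' cont) (auto simp: L_def)
      then show "w \<in> \<Phi> ` {-M..M}" by auto
    qed
  qed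
  have clamp: "clamp w \<in> {-L..L}" for w using L by (auto simp: clamp_def)
  have \<theta>: "\<theta> w \<in> {-M..M}" "\<Phi> (\<theta> w) = clamp w" for w
    using the_inv_into_into[OF inj _ order_refl, of "clamp w"] f_the_inv_into_f[OF inj, of "clamp w"]
      clamp[of w] unfolding img \<theta>_def by auto
  show thesis
  proof (rule that)
    have "continuous_on (\<Phi> ` {-M..M}) (the_inv_into {-M..M} \<Phi>)"
      using inj by (intro continuous_on_inv cont) (auto simp: the_inv_into_f_f)
    then show "continuous_on UNIV \<theta>"
      unfolding img \<theta>_def
      by (rule continuous_on_compose2) (use clamp in \<open>auto simp: clamp_def intro!: continuous_intros\<close>)
    show "mono \<theta>"
    proof
      fix v w :: real assume "v \<le> w"
      then have "\<Phi> (\<theta> v) \<le> \<Phi> (\<theta> w)" unfolding \<theta> by (auto simp: clamp_def)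
      then show "\<theta> v \<le> \<theta> w" using le \<theta>(1) by blast
    qed
    show "\<theta> w \<in> {-M..M}" for w by (rule \<theta>)
    show "\<theta> (\<Phi> u) = u" if "u \<in> {-M..M}" for u
    proof -
      have "clamp (\<Phi> u) = \<Phi> u" using img that by (force simp: clamp_def)
      then show ?thesis using inj that by (simp add: \<theta>_def the_inv_into_f_f)
    qed
    show "\<Phi> (\<theta> w) = w" if "\<bar>w\<bar> \<le> \<Phi> M" for w
      unfolding \<theta> using that by (auto simp: clamp_def L_def)
  qed
qed

text \<open>Integrals over the half-line are moved to the whole line, discarding at the same time the null set
  where the hypotheses on \<open>k\<close> and \<open>f\<close> fail.\<close>

lemma zero_extension:
  fixes h :: "real \<Rightarrow> real"
  assumes G: "G \<in> sets lebesgue" "G \<subseteq> {0..}" "AE t in lebesgue_on {0..}. t \<in> G"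
  shows zero_extension_measurable: "h \<in> borel_measurable (lebesgue_on {0..}) \<Longrightarrow>
      (\<lambda>t. if t \<in> G then h t else 0) \<in> borel_measurable lebesgue"
    and zero_extension_integrable: "integrable (lebesgue_on {0..}) h \<Longrightarrow>
      integrable lebesgue (\<lambda>t. if t \<in> G then h t else 0)"
    and zero_extension_integral: "h \<in> borel_measurable (lebesgue_on {0..}) \<Longrightarrow>
      (LINT t|lebesgue. (if t \<in> G then h t else 0)) = integral\<^sup>L (lebesgue_on {0..}) h"
proof -
  have m: "(\<lambda>t. if t \<in> G then h t else 0) \<in> borel_measurable lebesgue"
    if "h \<in> borel_measurable (lebesgue_on {0..})" for h :: "real \<Rightarrow> real"
    using borel_measurable_if_I[OF _ G(1)] measurable_restrict_mono[OF that G(2)] by blast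
  have ae: "AE t in lebesgue. (if t \<in> G then h t else 0) = (if t \<in> {0..} then h t else 0)"
    for h :: "real \<Rightarrow> real"
  proof -
    have "AE t in lebesgue. t \<in> {0..} \<longrightarrow> t \<in> G"
      using G(3) by (simp add: AE_restrict_space_iff)
    then show ?thesis by eventually_elim (use G(2) in auto)
  qed
  have ind: "(\<lambda>t. if t \<in> {0..} then h t else 0) = (\<lambda>t. indicat_real {0..} t *\<^sub>R h t)"
    for h :: "real \<Rightarrow> real"
    by (auto simp: indicator_def)
  have m0: "(\<lambda>t. if t \<in> {0..} then h t else 0) \<in> borel_measurable lebesgue"
    if "h \<in> borel_measurable (lebesgue_on {0..})" for h :: "real \<Rightarrow> real"
    using that by (intro borel_measurable_if_I) auto
  show "h \<in> borel_measurable (lebesgue_on {0..}) \<Longrightarrow>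
      (\<lambda>t. if t \<in> G then h t else 0) \<in> borel_measurable lebesgue"
    by (rule m)
  show "integrable lebesgue (\<lambda>t. if t \<in> G then h t else 0)" if h: "integrable (lebesgue_on {0..}) h"
  proof -
    have "integrable lebesgue (\<lambda>t. if t \<in> {0..} then h t else 0)"
      unfolding ind using h by (simp add: integrable_restrict_space)
    then show ?thesis
      using integrable_cong_AE[OF m m0 ae] h borel_measurable_integrable by blast
  qed
  show "(LINT t|lebesgue. (if t \<in> G then h t else 0)) = integral\<^sup>L (lebesgue_on {0..}) h"
    if h: "h \<in> borel_measurable (lebesgue_on {0..})"
  proof -
    have "(LINT t|lebesgue. (if t \<in> G then h t else 0)) = (LINT t|lebesgue. (if t \<in> {0..} then h t else 0))"
      by (rule integral_cong_AE[OF m[OF h] m0[OF h] ae])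
    also have "\<dots> = integral\<^sup>L (lebesgue_on {0..}) h"
      unfolding ind by (simp add: integral_restrict_space)
    finally show ?thesis .
  qed
qed

lemma
  fixes h :: "'s \<Rightarrow> 'a::euclidean_space \<times> 'b::euclidean_space"
  assumes h: "integrable M h" and A: "A \<in> sets M"
  shows fst_set_integral: "fst (LINT s:A|M. h s) = (LINT s:A|M. fst (h s))"
    and snd_set_integral: "snd (LINT s:A|M. h s) = (LINT s:A|M. snd (h s))"
  using integral_bounded_linear[OF bounded_linear_fst integrable_mult_indicator[OF A h]]
    integral_bounded_linear[OF bounded_linear_snd integrable_mult_indicator[OF A h]]
  by (simp_all add: set_lebesgue_integral_def)

text \<open>The existence result with the bound in its pointwise form, to which the clamping of \<open>x\<close> and \<open>w\<close> applies.
  The clamped inverse keeps \<open>k x'\<close> in \<open>{-M..M}\<close>, so monotonicity and oddness of \<open>\<Phi>\<close> enter on this interval.\<close>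

theorem half_line_solution_of_pointwise_bound:
  fixes \<nu>1 \<nu>2 kinf s M :: real and J :: "real set" and \<Phi> k \<psi> :: "real \<Rightarrow> real"
  assumes k_pos: "AE t in lebesgue_on {0<..}. 0 < k t"
    and k_int: "integrable (lebesgue_on {0..}) (\<lambda>t. 1 / k t)"
    and f_car: "caratheodory f"
    and kinf: "kinf = L1norm {0..} (\<lambda>t. 1 / k t)" "0 < kinf"
    and M: "0 < M" "{-M..M} \<subseteq> J" "continuous_on {-M..M} \<Phi>" "strict_mono_on {-M..M} \<Phi>"
      "\<And>u. u \<in> {-M..M} \<Longrightarrow> \<Phi> (- u) = - \<Phi> u"
    and \<psi>_int: "integrable (lebesgue_on {0..}) \<psi>"
    and s: "s = (\<nu>2 - \<nu>1) / kinf" "\<bar>s\<bar> \<le> M" "\<Phi> \<bar>s\<bar> + 2 * L1norm {0..} \<psi> \<le> \<Phi> M"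
    and f_bound: "AE t in lebesgue_on {0..}. \<forall>x u. \<bar>x\<bar> \<le> \<bar>\<nu>1\<bar> + kinf * M \<longrightarrow> \<bar>u\<bar> \<le> M \<longrightarrow>
        \<bar>f t x (u / k t)\<bar> \<le> \<psi> t"
  shows "\<exists>x. half_line_solution J \<Phi> k f \<nu>1 \<nu>2 x"
proof -
  define R where "R = \<bar>\<nu>1\<bar> + kinf * M"
  define c where "c = L1norm {0..} \<psi>"
  define good where "good t \<longleftrightarrow> 0 < k t \<and> continuous_on UNIV (\<lambda>(x, y). f t x y) \<and>
      (\<forall>x u. \<bar>x\<bar> \<le> R \<longrightarrow> \<bar>u\<bar> \<le> M \<longrightarrow> \<bar>f t x (u / k t)\<bar> \<le> \<psi> t)" for t
  have R: "0 \<le> R" using kinf(2) M(1) by (simp add: R_def)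
  have "AE t in lebesgue. 0 < t \<longrightarrow> good t"
    using k_pos f_car f_bound unfolding caratheodory_def good_def R_def
    by (auto simp: AE_restrict_space_iff)
  then obtain N where N: "N \<in> null_sets lebesgue" "{t. \<not> (0 < t \<longrightarrow> good t)} \<subseteq> N"
    by (auto simp: eventually_ae_filter)
  define G where "G = {0<..} - N"
  have G: "G \<in> sets lebesgue" "G \<subseteq> {0..}" "\<And>t. t \<in> G \<Longrightarrow> good t"
    using N by (auto simp: G_def)
  have G_AE: "AE t in lebesgue. 0 < t \<longrightarrow> t \<in> G"
    by (rule AE_I'[OF N(1)]) (auto simp: G_def)
  have G_AE0: "AE t in lebesgue. 0 \<le> t \<longrightarrow> t \<in> G \<and> 0 < t"
  proof -
    have "AE t in lebesgue. t \<noteq> (0::real)"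
      by (rule AE_I[where N = "{0}"]) auto
    with G_AE show ?thesis by eventually_elim auto
  qed
  then have "AE t in lebesgue. 0 \<le> t \<longrightarrow> t \<in> G" by eventually_elim simp
  then have G_on: "AE t in lebesgue_on {0..}. t \<in> G" by (simp add: AE_restrict_space_iff)
  note ext = zero_extension_measurable[OF G(1,2) G_on] zero_extension_integrable[OF G(1,2) G_on]
    zero_extension_integral[OF G(1,2) G_on]
  define \<kappa> where "\<kappa> t = (if t \<in> G then 1 / k t else 0)" for t
  define \<psi>' where "\<psi>' t = (if t \<in> G then \<psi> t else 0)" for t
  define g where "g t z = (if t \<in> G then f t (fst z) (snd z) else 0)" for t and z :: "real \<times> real"
  have \<kappa>: "integrable lebesgue \<kappa>" "\<And>t. 0 \<le> \<kappa> t"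
    using ext(2)[OF k_int] G(3) by (auto simp: \<kappa>_def[abs_def] good_def less_imp_le)
  have \<psi>'_nonneg: "0 \<le> \<psi>' t" for t
  proof (cases "t \<in> G")
    case True
    have "\<bar>f t x (u / k t)\<bar> \<le> \<psi> t" if "\<bar>x\<bar> \<le> R" "\<bar>u\<bar> \<le> M" for x u
      using G(3)[OF True] that unfolding good_def by blast
    from this[of 0 0] have "0 \<le> \<psi> t" using R M(1) by simp
    then show ?thesis by (simp add: \<psi>'_def True)
  qed (simp add: \<psi>'_def)
  have \<psi>': "integrable lebesgue \<psi>'" using ext(2)[OF \<psi>_int] by (simp add: \<psi>'_def[abs_def])
  have \<kappa>_eq: "(LINT t|lebesgue. \<kappa> t) = kinf"
  proof -
    have "(LINT t|lebesgue. \<kappa> t) = (LINT t|lebesgue. (if t \<in> G then \<bar>1 / k t\<bar> else 0))"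
    proof (rule Bochner_Integration.integral_cong[OF refl])
      show "\<kappa> t = (if t \<in> G then \<bar>1 / k t\<bar> else 0)" for t
        using G(3)[of t] by (auto simp: \<kappa>_def good_def)
    qed
    also have "\<dots> = kinf"
      unfolding kinf(1) L1norm_def
      by (intro ext(3) borel_measurable_integrable integrable_abs k_int)
    finally show ?thesis .
  qed
  have \<psi>'_eq: "(LINT t|lebesgue. \<psi>' t) = c"
  proof -
    have "(LINT t|lebesgue. \<psi>' t) = (LINT t|lebesgue. (if t \<in> G then \<bar>\<psi> t\<bar> else 0))"
    proof (rule Bochner_Integration.integral_cong[OF refl])
      show "\<psi>' t = (if t \<in> G then \<bar>\<psi> t\<bar> else 0)" for t
        using \<psi>'_nonneg[of t] by (auto simp: \<psi>'_def)
    qed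
    also have "\<dots> = c"
      unfolding c_def L1norm_def
      by (intro ext(3) borel_measurable_integrable integrable_abs \<psi>_int)
    finally show ?thesis .
  qed
  have c: "0 \<le> c" by (simp add: c_def L1norm_def)
  obtain \<theta> where \<theta>_cont: "continuous_on UNIV \<theta>" and \<theta>_mono: "mono \<theta>"
    and \<theta>_in: "\<And>w. \<theta> w \<in> {-M..M}" and \<theta>_left: "\<And>u. u \<in> {-M..M} \<Longrightarrow> \<theta> (\<Phi> u) = u"
    and \<theta>_right: "\<And>w. \<bar>w\<bar> \<le> \<Phi> M \<Longrightarrow> \<Phi> (\<theta> w) = w"
    using clamped_inverse[of M \<Phi>] M by auto
  define cl where "cl x = max (- R) (min R x)" for x
  define h where "h t z = (cl (fst z), \<theta> (snd z) * \<kappa> t)" for t and z :: "real \<times> real"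
  \<comment> \<open>The truncated field; the state is the pair \<open>(x, w)\<close>, and \<open>h\<close> supplies the arguments \<open>(x, x')\<close> of \<open>f\<close>.\<close>
  define H where "H t z = (\<theta> (snd z) * \<kappa> t, g t (h t z))" for t and z :: "real \<times> real"
  have g_cont: "continuous_on UNIV (g t)" for t
  proof (cases "t \<in> G")
    case True
    then show ?thesis
      using G(3)[OF True] by (simp add: g_def[abs_def] good_def case_prod_unfold)
  qed (simp add: g_def[abs_def])
  have g_meas: "(\<lambda>t. g t z) \<in> borel_measurable lebesgue" for z
    unfolding g_def using f_car by (intro ext(1)) (simp add: caratheodory_def)
  have \<kappa>_meas: "\<kappa> \<in> borel_measurable lebesgue" using \<kappa>(1) by (rule borel_measurable_integrable)
  have g_le: "\<bar>g t (h t z)\<bar> \<le> \<psi>' t" for t z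
  proof (cases "t \<in> G")
    case True
    have "\<bar>cl (fst z)\<bar> \<le> R" using R by (auto simp: cl_def)
    moreover have "\<bar>\<theta> (snd z)\<bar> \<le> M" using \<theta>_in[of "snd z"] by auto
    ultimately show ?thesis
      using G(3)[OF True] unfolding good_def by (simp add: True g_def h_def \<psi>'_def \<kappa>_def)
  qed (simp add: g_def \<psi>'_def)
  have \<theta>\<kappa>_le: "\<bar>\<theta> w * \<kappa> t\<bar> \<le> M * \<kappa> t" for w t
    using \<theta>_in[of w] \<kappa>(2)[of t] by (auto simp: abs_mult intro!: mult_right_mono)
  interpret bounded_caratheodory H "\<lambda>t. M * \<kappa> t + \<psi>' t"
  proof
    show "(\<lambda>t. H t z) \<in> borel_measurable lebesgue" for z
    proof -
      have "(\<lambda>t. h t z) \<in> borel_measurable lebesgue"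
        unfolding h_def using \<kappa>_meas by (intro borel_measurable_Pair) auto
      from borel_measurable_caratheodory_comp[OF g_meas g_cont this]
      show ?thesis unfolding H_def using \<kappa>_meas by (intro borel_measurable_Pair) auto
    qed
    show "continuous_on UNIV (H t)" for t
    proof -
      have \<theta>s: "continuous_on UNIV (\<lambda>z. \<theta> (snd z))"
        by (rule continuous_on_compose2[OF \<theta>_cont]) (auto intro!: continuous_intros)
      have "continuous_on UNIV (h t)"
        unfolding h_def[abs_def] cl_def by (intro continuous_intros \<theta>s)
      then have "continuous_on UNIV (\<lambda>z. g t (h t z))"
        by (rule continuous_on_compose2[OF g_cont]) auto
      then show ?thesis unfolding H_def[abs_def] by (intro continuous_intros \<theta>s)
    qed
    show "norm (H t z) \<le> M * \<kappa> t + \<psi>' t" for t z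
      using norm_Pair_le[of "\<theta> (snd z) * \<kappa> t" "g t (h t z)"] \<theta>\<kappa>_le[of "snd z" t] g_le[of t z]
      unfolding H_def real_norm_def by linarith
    show "integrable lebesgue (\<lambda>t. M * \<kappa> t + \<psi>' t)" using \<kappa>(1) \<psi>' by simp
  qed
  have intfst: "integrable lebesgue (\<lambda>t. \<theta> (snd (u t)) * \<kappa> t)"
    and intsnd: "integrable lebesgue (\<lambda>t. g t (h t (u t)))"
    if "continuous_on UNIV u" for u
    using integrable_fst[OF integrable_comp] integrable_snd[OF integrable_comp]
      integrable_comp[OF continuous_on_UNIV_measurable_lebesgue[OF that]]
    by (auto simp: H_def dest: integrable_bounded_linear[OF bounded_linear_fst]
       integrable_bounded_linear[OF bounded_linear_snd])
  have picard_fst: "fst (picard z u t) = fst z + (LINT s:{0..t}|lebesgue. \<theta> (snd (u s)) * \<kappa> s)"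
    and picard_snd: "snd (picard z u t) = snd z + (LINT s:{0..t}|lebesgue. g s (h s (u s)))"
    and end_fst: "fst (picard_end z u) = fst z + (LINT s:{0..}|lebesgue. \<theta> (snd (u s)) * \<kappa> s)"
    if "continuous_on UNIV u" for z u t
    using integrable_comp[OF continuous_on_UNIV_measurable_lebesgue[OF that]]
    by (auto simp: picard_def picard_end_def fst_set_integral snd_set_integral H_def)
  have snd_near: "\<bar>snd (picard z u t) - snd z\<bar> \<le> c" if "continuous_on UNIV u" for z u t
    using norm_set_integral_le[OF intsnd[OF that] \<psi>', of "{0..t}"] g_le
    by (simp add: picard_snd[OF that] \<psi>'_eq)
  have \<kappa>_half: "(LINT t:{0..}|lebesgue. a * \<kappa> t) = a * kinf" for a
  proof -
    have "(LINT t:{0..}|lebesgue. a * \<kappa> t) = (LINT t|lebesgue. a * \<kappa> t)"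
      unfolding set_lebesgue_integral_def
      using G(2) by (intro Bochner_Integration.integral_cong) (auto simp: \<kappa>_def indicator_def)
    then show ?thesis by (simp add: \<kappa>_eq)
  qed
  have s_kinf: "\<nu>1 + s * kinf = \<nu>2" using kinf(2) by (simp add: s(1))
  have s_in: "s \<in> {-M..M}" using s(2) by auto
  have picard_cont: "continuous_on UNIV (\<lambda>r. picard z u (r - \<delta>))" if "continuous_on UNIV u" for z u \<delta>
    by (intro continuous_on_delay continuous_picard continuous_on_UNIV_measurable_lebesgue that)
  have lo: "fst (picard_end (\<nu>1, \<Phi> s - c) (\<lambda>r. picard (\<nu>1, \<Phi> s - c) u (r - \<delta>))) \<le> \<nu>2"
    if u: "continuous_on UNIV u" for u \<delta>
  proof -
    let ?v = "\<lambda>r. picard (\<nu>1, \<Phi> s - c) u (r - \<delta>)"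
    have "\<theta> (snd (?v r)) \<le> s" for r
    proof -
      have "snd (?v r) \<le> \<Phi> s" using snd_near[OF u, of "(\<nu>1, \<Phi> s - c)" "r - \<delta>"] by simp
      from monoD[OF \<theta>_mono this] show ?thesis by (simp add: \<theta>_left[OF s_in])
    qed
    then have "(LINT r:{0..}|lebesgue. \<theta> (snd (?v r)) * \<kappa> r) \<le> (LINT r:{0..}|lebesgue. s * \<kappa> r)"
      using \<kappa> by (intro set_integral_mono set_integrable_of_integrable intfst picard_cont u)
        (auto intro!: mult_right_mono)
    then show ?thesis using s_kinf unfolding \<kappa>_half end_fst[OF picard_cont[OF u]] by simp
  qed
  have hi: "\<nu>2 \<le> fst (picard_end (\<nu>1, \<Phi> s + c) (\<lambda>r. picard (\<nu>1, \<Phi> s + c) u (r - \<delta>)))"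
    if u: "continuous_on UNIV u" for u \<delta>
  proof -
    let ?v = "\<lambda>r. picard (\<nu>1, \<Phi> s + c) u (r - \<delta>)"
    have "s \<le> \<theta> (snd (?v r))" for r
    proof -
      have "\<Phi> s \<le> snd (?v r)" using snd_near[OF u, of "(\<nu>1, \<Phi> s + c)" "r - \<delta>"] by simp
      from monoD[OF \<theta>_mono this] show ?thesis by (simp add: \<theta>_left[OF s_in])
    qed
    then have "(LINT r:{0..}|lebesgue. s * \<kappa> r) \<le> (LINT r:{0..}|lebesgue. \<theta> (snd (?v r)) * \<kappa> r)"
      using \<kappa> by (intro set_integral_mono set_integrable_of_integrable intfst picard_cont u)
        (auto intro!: mult_right_mono)
    then show ?thesis using s_kinf unfolding \<kappa>_half end_fst[OF picard_cont[OF u]] by simp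
  qed
  obtain C y where C: "C \<in> {\<Phi> s - c..\<Phi> s + c}" and y_cont: "continuous_on UNIV y"
    and y: "y = picard (\<nu>1, C) y" and y_end: "fst (picard_end (\<nu>1, C) y) = \<nu>2"
    by (rule shooting[of "\<Phi> s - c" "\<Phi> s + c" "\<lambda>C. (\<nu>1, C)" fst \<nu>2])
       (use c lo hi in \<open>auto intro!: continuous_intros\<close>)
  define x where "x t = fst (y t)" for t
  define w where "w t = snd (y t)" for t
  have x_eq: "x = (\<lambda>t. \<nu>1 + (LINT s:{0..t}|lebesgue. \<theta> (w s) * \<kappa> s))"
    using picard_fst[OF y_cont, of "(\<nu>1, C)"] y by (simp add: x_def w_def fun_eq_iff)
  have w_eq: "w = (\<lambda>t. C + (LINT s:{0..t}|lebesgue. g s (h s (y s))))"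
    using picard_snd[OF y_cont, of "(\<nu>1, C)"] y by (simp add: w_def fun_eq_iff)
  have int_x: "integrable lebesgue (\<lambda>t. \<theta> (w t) * \<kappa> t)"
    using intfst[OF y_cont] by (simp add: w_def)
  note int_w = intsnd[OF y_cont]
  \<comment> \<open>The two bounds show that neither clamp is active along the solution.\<close>
  have w_le: "\<bar>w t\<bar> \<le> \<Phi> M" for t
  proof -
    have "\<bar>w t - C\<bar> \<le> c"
      using snd_near[OF y_cont, of "(\<nu>1, C)" t] y unfolding w_def by simp
    moreover have "\<bar>\<Phi> s\<bar> \<le> \<Phi> \<bar>s\<bar>"
    proof -
      have "\<Phi> 0 = 0" using M(5)[of 0] M(1) by auto
      then have "0 \<le> \<Phi> \<bar>s\<bar>"
        using strict_mono_on_less_eq[OF M(4), of 0 "\<bar>s\<bar>"] s(2) by auto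
      moreover have "\<Phi> \<bar>s\<bar> = \<Phi> s \<or> \<Phi> \<bar>s\<bar> = - \<Phi> s"
        using M(5)[OF s_in] by (cases "0 \<le> s") auto
      ultimately show ?thesis by auto
    qed
    ultimately show ?thesis using C s(3) unfolding c_def[symmetric] by auto
  qed
  have x_le: "\<bar>x t\<bar> \<le> R" for t
  proof -
    have "\<bar>LINT s:{0..t}|lebesgue. \<theta> (w s) * \<kappa> s\<bar> \<le> (LINT s|lebesgue. M * \<kappa> s)"
      using norm_set_integral_le[OF int_x, of "\<lambda>s. M * \<kappa> s" "{0..t}"] \<theta>\<kappa>_le \<kappa>(1) by simp
    then show ?thesis by (simp add: x_eq R_def \<kappa>_eq mult.commute)
  qed
  have "half_line_solution J \<Phi> k f \<nu>1 \<nu>2 x"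
    unfolding half_line_solution_def
  proof (intro conjI exI[of _ w])
    show "locally_abs_cont x" unfolding x_eq by (rule locally_abs_cont_indefinite_integral[OF int_x])
    show "locally_abs_cont w" unfolding w_eq by (rule locally_abs_cont_indefinite_integral[OF int_w])
    show "x 0 = \<nu>1" unfolding x_def by (subst y) (simp add: picard_start)
    have "(x \<longlongrightarrow> \<nu>1 + (LINT s:{0..}|lebesgue. \<theta> (w s) * \<kappa> s)) at_top"
      unfolding x_eq by (intro tendsto_intros tendsto_indefinite_set_integral_at_top int_x)
    then show "(x \<longlongrightarrow> \<nu>2) at_top"
      using y_end by (simp add: end_fst[OF y_cont] w_def)
    have "AE t in lebesgue. 0 < t \<longrightarrow> (x has_real_derivative \<theta> (w t) * \<kappa> t) (at t)"
      using AE_has_derivative_indefinite_integral[OF int_x] unfolding x_eq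
      by eventually_elim (auto intro!: derivative_eq_intros)
    moreover have "AE t in lebesgue. 0 < t \<longrightarrow> (w has_real_derivative g t (h t (y t))) (at t)"
      using AE_has_derivative_indefinite_integral[OF int_w]
      by (subst w_eq, eventually_elim) (auto intro!: derivative_eq_intros)
    ultimately have "AE t in lebesgue. 0 \<le> t \<longrightarrow> (\<exists>p.
           (x has_real_derivative p) (at t) \<and>
           k t * p \<in> J \<and> w t = \<Phi> (k t * p) \<and>
           (w has_real_derivative f t (x t) p) (at t))"
      using G_AE0
    proof eventually_elim
      case (elim t)
      show ?case
      proof
        assume "0 \<le> t"
        with elim have t: "0 < t" "t \<in> G" by auto
        have kt: "0 < k t" using G(3)[OF t(2)] by (simp add: good_def)
        then have kp: "k t * (\<theta> (w t) * \<kappa> t) = \<theta> (w t)" by (simp add: \<kappa>_def t)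
        have g_eq: "g t (h t (y t)) = f t (x t) (\<theta> (w t) * \<kappa> t)"
          using x_le[of t] by (simp add: g_def h_def t cl_def x_def w_def)
        show "\<exists>p. (x has_real_derivative p) (at t) \<and>
           k t * p \<in> J \<and> w t = \<Phi> (k t * p) \<and>
           (w has_real_derivative f t (x t) p) (at t)"
        proof (intro exI[of _ "\<theta> (w t) * \<kappa> t"] conjI)
          show "(x has_real_derivative \<theta> (w t) * \<kappa> t) (at t)" using elim(1) t(1) by blast
          show "k t * (\<theta> (w t) * \<kappa> t) \<in> J" unfolding kp using \<theta>_in M(2) by blast
          show "w t = \<Phi> (k t * (\<theta> (w t) * \<kappa> t))" unfolding kp using \<theta>_right[OF w_le] by simp
          show "(w has_real_derivative f t (x t) (\<theta> (w t) * \<kappa> t)) (at t)"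
            using elim(2) t(1) unfolding g_eq by blast
        qed
      qed
    qed
    then show "AE t in lebesgue_on {0..}. \<exists>p.
           (x has_real_derivative p) (at t) \<and>
           k t * p \<in> J \<and> w t = \<Phi> (k t * p) \<and>
           (w has_real_derivative f t (x t) p) (at t)"
      by (simp add: AE_restrict_space_iff)
  qed
  then show ?thesis by blast
qed

text \<open>For \<open>h = 1 / k\<close> this gives \<open>0 < k\<^sub>T \<le> k\<^sub>\<infinity>\<close>, whence \<open>\<bar>s\<^sub>\<infinity>\<bar> \<le> \<bar>s\<^sub>T\<bar>\<close>.\<close>

lemma L1norm_mono_pos:
  fixes h :: "real \<Rightarrow> real"
  assumes h: "integrable (lebesgue_on {0..}) h" and pos: "AE t in lebesgue_on {0<..}. 0 < h t"
    and "0 < T"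
  shows "0 < L1norm {0..T} h" "L1norm {0..T} h \<le> L1norm {0..} h"
proof -
  define g where "g t = indicat_real {0..} t * \<bar>h t\<bar>" for t
  have g: "integrable lebesgue g"
    using integrable_abs[OF h] by (simp add: integrable_restrict_space g_def[abs_def])
  have g_nonneg: "0 \<le> g t" for t by (simp add: g_def)
  have L1: "L1norm A h = (LINT t|lebesgue. indicator A t * g t)" if "A \<subseteq> {0..}" "A \<in> sets lebesgue" for A
  proof -
    have "L1norm A h = (LINT t|lebesgue. indicator A t * \<bar>h t\<bar>)"
      using that by (simp add: L1norm_def integral_restrict_space)
    also have "\<dots> = (LINT t|lebesgue. indicator A t * g t)"
      using that(1) by (intro Bochner_Integration.integral_cong) (auto simp: g_def indicator_def)
    finally show ?thesis .
  qed
  have int: "integrable lebesgue (\<lambda>t. indicator A t * g t)" if "A \<in> sets lebesgue" for A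
    using integrable_mult_indicator[OF that g] by simp
  show "L1norm {0..T} h \<le> L1norm {0..} h"
    using g_nonneg by (simp add: L1) (intro integral_mono int; auto simp: indicator_def)
  have "L1norm {0..T} h \<noteq> 0"
  proof
    assume "L1norm {0..T} h = 0"
    then have "AE t in lebesgue. indicator {0..T} t * g t = 0"
      using integral_nonneg_eq_0_iff_AE[OF int, of "{0..T}"] g_nonneg by (simp add: L1)
    moreover have "AE t in lebesgue. 0 < t \<longrightarrow> 0 < h t"
      using pos by (simp add: AE_restrict_space_iff)
    ultimately have "AE t in lebesgue. t \<notin> {0<..<T}"
      by eventually_elim (auto simp: g_def)
    then have "{0<..<T} \<in> null_sets lebesgue"
      by (subst AE_iff_null_sets) auto
    then have "negligible {0<..<T}" by (simp add: negligible_iff_null_sets)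
    then show False
      using open_not_negligible[of "{0<..<T}"] \<open>0 < T\<close> by auto
  qed
  moreover have "0 \<le> L1norm {0..T} h" by (simp add: L1norm_def)
  ultimately show "0 < L1norm {0..T} h" by simp
qed

text \<open>The exceptional null set of the hypothesis depends on \<open>x\<close> and \<open>y\<close>. Taking \<open>y = u / k\<close> and rational
  \<open>x\<close>, \<open>u\<close> leaves countably many null sets; off their union, continuity of \<open>f t\<close> extends the bound to
  the closed rectangle. The closed form is the one needed, as the clamped state may attain the boundary.\<close>

lemma pointwise_bound_of_superposition_bound:
  fixes f :: "real \<Rightarrow> real \<Rightarrow> real \<Rightarrow> real" and k \<psi> :: "real \<Rightarrow> real"
  assumes k_pos: "AE t in lebesgue_on {0<..}. 0 < k t"
    and k_int: "integrable (lebesgue_on {0..}) (\<lambda>t. 1 / k t)"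
    and f_car: "caratheodory f" and "0 < R" "0 < M"
    and f_bound: "\<And>x y. integrable (lebesgue_on {0..}) y \<Longrightarrow> \<bar>x\<bar> < R \<Longrightarrow>
        (AE t in lebesgue_on {0..}. \<bar>y t\<bar> < 1 / k t * M) \<Longrightarrow>
        (AE t in lebesgue_on {0..}. \<bar>f t x (y t)\<bar> \<le> \<psi> t)"
  shows "AE t in lebesgue_on {0..}. \<forall>x u. \<bar>x\<bar> \<le> R \<longrightarrow> \<bar>u\<bar> \<le> M \<longrightarrow>
        \<bar>f t x (u / k t)\<bar> \<le> \<psi> t"
proof -
  let ?D = "({-R<..<R} \<inter> \<rat>) \<times> ({-M<..<M} \<inter> \<rat>)"
  have "AE t in lebesgue. t \<noteq> (0::real)"
    by (rule AE_I[where N = "{0}"]) auto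
  moreover have "AE t in lebesgue. 0 < t \<longrightarrow> 0 < k t"
    using k_pos by (simp add: AE_restrict_space_iff)
  ultimately have "AE t in lebesgue. 0 \<le> t \<longrightarrow> 0 < k t"
    by eventually_elim auto
  then have k_pos0: "AE t in lebesgue_on {0..}. 0 < k t"
    by (simp add: AE_restrict_space_iff)
  have AE_D: "\<forall>z\<in>?D. AE t in lebesgue_on {0..}. \<bar>f t (fst z) (snd z / k t)\<bar> \<le> \<psi> t"
  proof
    fix z assume "z \<in> ?D"
    then have z: "\<bar>fst z\<bar> < R" "\<bar>snd z\<bar> < M" by auto
    show "AE t in lebesgue_on {0..}. \<bar>f t (fst z) (snd z / k t)\<bar> \<le> \<psi> t"
    proof (rule f_bound[OF _ z(1)])
      show "integrable (lebesgue_on {0..}) (\<lambda>t. snd z / k t)"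
        using integrable_mult_right[OF k_int, of "snd z"] by simp
      show "AE t in lebesgue_on {0..}. \<bar>snd z / k t\<bar> < 1 / k t * M"
        using k_pos0 by eventually_elim (use z(2) in \<open>simp add: divide_simps\<close>)
    qed
  qed
  have "countable ?D"
    using countable_rat by (intro countable_SIGMA countable_Int2) auto
  from AE_ball_countable[OF this] AE_D
  have "AE t in lebesgue_on {0..}. \<forall>z\<in>?D. \<bar>f t (fst z) (snd z / k t)\<bar> \<le> \<psi> t"
    by (rule iffD2)
  moreover have "AE t in lebesgue_on {0..}. continuous_on UNIV (\<lambda>(x, y). f t x y)"
    using f_car by (simp add: caratheodory_def)
  ultimately show ?thesis using k_pos0
  proof eventually_elim
    case (elim t)
    let ?S = "{z. \<bar>f t (fst z) (snd z / k t)\<bar> \<le> \<psi> t}"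
    have "continuous_on UNIV (\<lambda>z. (case (fst z, snd z / k t) of (x, y) \<Rightarrow> f t x y))"
      by (rule continuous_on_compose2[OF elim(2)]) (use elim(3) in \<open>auto intro!: continuous_intros\<close>)
    then have "closed ?S"
      by (intro closed_Collect_le continuous_on_rabs continuous_on_const) simp
    moreover have "?D \<subseteq> ?S" using elim(1) by blast
    ultimately have "closure ?D \<subseteq> ?S" by (rule closure_minimal[rotated])
    moreover have "closure ({-r<..<r} \<inter> \<rat>) = {-r..r}" if "0 < r" for r :: real
    proof -
      have "closure ({-r<..<r} \<inter> \<rat>) = closure {-r<..<r}"
        by (rule closure_open_Int_superset) (auto simp: Rats_closure_real)
      then show ?thesis using that by simp
    qed
    ultimately have sub: "{-R..R} \<times> {-M..M} \<subseteq> ?S"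
      using \<open>0 < R\<close> \<open>0 < M\<close> by (simp add: closure_Times)
    show ?case
    proof (intro allI impI)
      fix x u assume "\<bar>x\<bar> \<le> R" "\<bar>u\<bar> \<le> M"
      then have "(x, u) \<in> {-R..R} \<times> {-M..M}" by auto
      with sub have "(x, u) \<in> ?S" by blast
      then show "\<bar>f t x (u / k t)\<bar> \<le> \<psi> t" by simp
    qed
  qed
qed

theorem half_line_solution_increasing:
  fixes \<nu>1 \<nu>2 T kinf sinf sT M :: real
    and J Jstar :: "real set"
    and \<Phi> k \<psi> :: "real \<Rightarrow> real"
    and f :: "real \<Rightarrow> real \<Rightarrow> real \<Rightarrow> real"
  assumes \<Phi>_cont: "continuous_on J \<Phi>"
    and k_pos: "AE t in lebesgue_on {0<..}. 0 < k t"
    and k_int: "integrable (lebesgue_on {0..}) (\<lambda>t. 1 / k t)"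
    and f_car: "caratheodory f"
    and kinf: "kinf = L1norm {0..} (\<lambda>t. 1 / k t)"
    and sT: "sT = (\<nu>2 - \<nu>1) / L1norm {0..T} (\<lambda>t. 1 / k t)"
    and Jstar: "Jstar \<subseteq> J" "is_interval Jstar" "\<forall>u\<in>Jstar. - u \<in> Jstar"
    and \<Phi>_mono: "strict_mono_on Jstar \<Phi>"
    and \<Phi>_odd: "\<forall>u\<in>Jstar. \<Phi> (- u) = - \<Phi> u"
    and T: "0 < T" "sT \<in> Jstar"
    and \<psi>_int: "integrable (lebesgue_on {0..}) \<psi>"
    and M: "M \<in> Jstar" "\<Phi> M = \<Phi> \<bar>sT\<bar> + 2 * L1norm {0..} \<psi>"
    and nondegenerate: "\<nu>1 \<noteq> \<nu>2 \<or> L1norm {0..} \<psi> \<noteq> 0"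
    and f_bound: "\<forall>x y. integrable (lebesgue_on {0..}) y \<longrightarrow>
        \<bar>x\<bar> < \<bar>\<nu>1\<bar> + kinf * M \<longrightarrow>
        (AE t in lebesgue_on {0..}. \<bar>y t\<bar> < 1 / k t * M) \<longrightarrow>
        (AE t in lebesgue_on {0..}. \<bar>f t x (y t)\<bar> \<le> \<psi> t)"
  shows "\<exists>x. half_line_solution J \<Phi> k f \<nu>1 \<nu>2 x"
proof -
  have "AE t in lebesgue_on {0<..}. 0 < 1 / k t"
    using k_pos by eventually_elim simp
  note kT = L1norm_mono_pos[OF k_int this T(1)]
  have kinf_pos: "0 < kinf" using kT by (simp add: kinf)
  define s where "s = (\<nu>2 - \<nu>1) / kinf"
  have s_le: "\<bar>s\<bar> \<le> \<bar>sT\<bar>"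
    using kT kinf_pos by (simp add: s_def sT abs_divide) (simp add: kinf divide_left_mono)
  have sT_in: "\<bar>sT\<bar> \<in> Jstar" using T(2) Jstar(3) by (auto simp: abs_if)
  have between: "u \<in> Jstar" if "a \<in> Jstar" "b \<in> Jstar" "a \<le> u" "u \<le> b" for a b u
    using Jstar(2) that by (metis is_interval_1)
  have \<psi>0: "0 \<le> L1norm {0..} \<psi>" by (simp add: L1norm_def)
  have "\<Phi> \<bar>sT\<bar> \<le> \<Phi> M" using M(2) \<psi>0 by simp
  then have sT_M: "\<bar>sT\<bar> \<le> M" using strict_mono_on_less_eq[OF \<Phi>_mono sT_in M(1)] by simp
  \<comment> \<open>The radius vanishes only if \<open>\<nu>1 = \<nu>2\<close> and \<open>\<psi>\<close> is null, and then no \<open>y\<close> satisfies the strict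
    inequality in the growth condition.\<close>
  have M_pos: "0 < M"
  proof (cases "\<nu>1 = \<nu>2")
    case True
    then have "\<Phi> \<bar>sT\<bar> < \<Phi> M" using nondegenerate M(2) \<psi>0 by simp
    then have "\<bar>sT\<bar> \<noteq> M" by auto
    with sT_M show ?thesis by linarith
  next
    case False
    then have "0 < \<bar>sT\<bar>" using kT(1) by (simp add: sT)
    with sT_M show ?thesis by linarith
  qed
  have sub: "{-M..M} \<subseteq> Jstar"
    using between[of "-M" M] M(1) Jstar(3) by auto
  have s_in: "\<bar>s\<bar> \<in> Jstar" using sub s_le sT_M by auto
  have "\<Phi> \<bar>s\<bar> \<le> \<Phi> \<bar>sT\<bar>"
    using strict_mono_on_less_eq[OF \<Phi>_mono s_in sT_in] s_le by simp
  then have \<Phi>s: "\<Phi> \<bar>s\<bar> + 2 * L1norm {0..} \<psi> \<le> \<Phi> M" using M(2) by simp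
  have R: "0 < \<bar>\<nu>1\<bar> + kinf * M" using kinf_pos M_pos by (simp add: add_nonneg_pos)
  show ?thesis
  proof (rule half_line_solution_of_pointwise_bound[OF k_pos k_int f_car kinf kinf_pos M_pos _ _ _ _ \<psi>_int s_def _ \<Phi>s])
    show "{-M..M} \<subseteq> J" using sub Jstar(1) by blast
    then show "continuous_on {-M..M} \<Phi>" using \<Phi>_cont continuous_on_subset by blast
    show "strict_mono_on {-M..M} \<Phi>"
      using \<Phi>_mono sub by (meson monotone_on_subset)
    show "\<Phi> (- u) = - \<Phi> u" if "u \<in> {-M..M}" for u using \<Phi>_odd sub that by blast
    show "\<bar>s\<bar> \<le> M" using s_le sT_M by simp
    show "AE t in lebesgue_on {0..}. \<forall>x u. \<bar>x\<bar> \<le> \<bar>\<nu>1\<bar> + kinf * M \<longrightarrow> \<bar>u\<bar> \<le> M \<longrightarrow>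
        \<bar>f t x (u / k t)\<bar> \<le> \<psi> t"
      by (rule pointwise_bound_of_superposition_bound[OF k_pos k_int f_car R M_pos])
         (use f_bound in blast)
  qed
qed

lemma locally_abs_cont_minus: "locally_abs_cont w \<Longrightarrow> locally_abs_cont (\<lambda>t. - w t)"
  unfolding locally_abs_cont_def abs_cont_on_def by (simp add: abs_minus_commute)

text \<open>The sign change that reduces decreasing \<open>\<Phi>\<close> to increasing \<open>\<Phi>\<close>: \<open>x\<close> is kept and \<open>w\<close> changes sign.\<close>

lemma half_line_solution_uminus:
  assumes "half_line_solution J (\<lambda>u. - \<Phi> u) k (\<lambda>t x y. - f t x y) \<nu>1 \<nu>2 x"
  shows "half_line_solution J \<Phi> k f \<nu>1 \<nu>2 x"
proof -
  obtain w where w: "locally_abs_cont w" "AE t in lebesgue_on {0..}. \<exists>p.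
           (x has_real_derivative p) (at t) \<and> k t * p \<in> J \<and> w t = - \<Phi> (k t * p) \<and>
           (w has_real_derivative - f t (x t) p) (at t)"
    using assms unfolding half_line_solution_def by blast
  have "AE t in lebesgue_on {0..}. \<exists>p.
           (x has_real_derivative p) (at t) \<and> k t * p \<in> J \<and> - w t = \<Phi> (k t * p) \<and>
           ((\<lambda>t. - w t) has_real_derivative f t (x t) p) (at t)"
    using w(2)
  proof eventually_elim
    case (elim t)
    then obtain p where p: "(x has_real_derivative p) (at t)" "k t * p \<in> J" "w t = - \<Phi> (k t * p)"
       "(w has_real_derivative - f t (x t) p) (at t)" by blast
    from DERIV_minus[OF p(4)] p show ?case by (intro exI[of _ p]) simp
  qed
  with assms locally_abs_cont_minus[OF w(1)] show ?thesis
    unfolding half_line_solution_def by (intro conjI exI[of _ "\<lambda>t. - w t"]) auto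
qed

lemma caratheodory_uminus: "caratheodory f \<Longrightarrow> caratheodory (\<lambda>t x y. - f t x y)"
  unfolding caratheodory_def
  by (auto simp: case_prod_unfold intro!: continuous_on_minus borel_measurable_uminus
      elim!: AE_mp)

theorem theorem5p3:
  fixes \<nu>1 \<nu>2 T kinf sinf sT M :: real
    and J Jstar :: "real set"
    and \<Phi> k \<psi> :: "real \<Rightarrow> real"
    and f :: "real \<Rightarrow> real \<Rightarrow> real \<Rightarrow> real"
  assumes J: "open J" "is_interval J"
    and \<Phi>_cont: "continuous_on J \<Phi>"
    and k_meas: "k \<in> borel_measurable (lebesgue_on {0..})"
    and k_pos: "AE t in lebesgue_on {0<..}. 0 < k t"
    and k_int: "integrable (lebesgue_on {0..}) (\<lambda>t. 1 / k t)"
    and f_car: "caratheodory f"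
    and kinf: "kinf = L1norm {0..} (\<lambda>t. 1 / k t)"
    and sinf: "sinf = (\<nu>2 - \<nu>1) / kinf"
    and sT: "sT = (\<nu>2 - \<nu>1) / L1norm {0..T} (\<lambda>t. 1 / k t)"
    and Jstar: "Jstar \<subseteq> J" "open Jstar" "is_interval Jstar" "\<forall>u\<in>Jstar. - u \<in> Jstar"
    and sinf_in: "sinf \<in> Jstar"
    and \<Phi>_mono: "strict_mono_on Jstar \<Phi> \<or> strict_antimono_on Jstar \<Phi>"
    and \<Phi>_odd: "\<forall>u\<in>Jstar. \<Phi> (- u) = - \<Phi> u"
    and T: "0 < T" "sT \<in> Jstar"
    and \<psi>_int: "integrable (lebesgue_on {0..}) \<psi>"
    and \<psi>_plus: "\<Phi> sT + 2 * L1norm {0..} \<psi> \<in> \<Phi> ` Jstar"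
    and \<psi>_minus: "\<Phi> sT - 2 * L1norm {0..} \<psi> \<in> \<Phi> ` Jstar"
    and M: "M = slope_bound Jstar \<Phi> sT (L1norm {0..} \<psi>)"
    and nondegenerate: "\<nu>1 \<noteq> \<nu>2 \<or> L1norm {0..} \<psi> \<noteq> 0"
    and f_bound: "\<forall>x y. integrable (lebesgue_on {0..}) y \<longrightarrow>
        \<bar>x\<bar> < \<bar>\<nu>1\<bar> + kinf * M \<longrightarrow>
        (AE t in lebesgue_on {0..}. \<bar>y t\<bar> < 1 / k t * M) \<longrightarrow>
        (AE t in lebesgue_on {0..}. \<bar>f t x (y t)\<bar> \<le> \<psi> t)"
  shows "\<exists>x. half_line_solution J \<Phi> k f \<nu>1 \<nu>2 x"
proof -
  let ?c = "L1norm {0..} \<psi>"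
  have neg: "- w \<in> \<Phi> ` Jstar" if "w \<in> \<Phi> ` Jstar" for w
  proof -
    from that obtain u where "u \<in> Jstar" "w = \<Phi> u" by blast
    then have "- u \<in> Jstar" "- w = \<Phi> (- u)" using \<Phi>_odd Jstar(4) by auto
    then show ?thesis by blast
  qed
  have abs_in: "\<Phi> \<bar>sT\<bar> + 2 * ?c \<in> \<Phi> ` Jstar" "\<Phi> \<bar>sT\<bar> - 2 * ?c \<in> \<Phi> ` Jstar"
  proof -
    have "\<Phi> \<bar>sT\<bar> = \<Phi> sT \<or> \<Phi> \<bar>sT\<bar> = - \<Phi> sT" using \<Phi>_odd T(2) by (auto simp: abs_if)
    moreover have "- \<Phi> sT - 2 * ?c \<in> \<Phi> ` Jstar" "- \<Phi> sT + 2 * ?c \<in> \<Phi> ` Jstar"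
      using neg[OF \<psi>_plus] neg[OF \<psi>_minus] by (simp_all add: algebra_simps)
    ultimately show "\<Phi> \<bar>sT\<bar> + 2 * ?c \<in> \<Phi> ` Jstar" "\<Phi> \<bar>sT\<bar> - 2 * ?c \<in> \<Phi> ` Jstar"
      using \<psi>_plus \<psi>_minus by metis+
  qed
  show ?thesis
  proof (cases "strict_mono_on Jstar \<Phi>")
    case True
    then have inj: "inj_on \<Phi> Jstar" by (rule strict_mono_on_imp_inj_on)
    have M_eq: "M = the_inv_into Jstar \<Phi> (\<Phi> \<bar>sT\<bar> + 2 * ?c)"
      using True by (simp add: M slope_bound_def)
    have "M \<in> Jstar" "\<Phi> M = \<Phi> \<bar>sT\<bar> + 2 * ?c"
      unfolding M_eq using the_inv_into_into[OF inj abs_in(1) order_refl]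
        f_the_inv_into_f[OF inj abs_in(1)] by auto
    with half_line_solution_increasing[OF \<Phi>_cont k_pos k_int f_car kinf sT Jstar(1,3,4) True
        \<Phi>_odd T \<psi>_int _ _ nondegenerate f_bound]
    show ?thesis by blast
  next
    case False
    with \<Phi>_mono have anti: "strict_antimono_on Jstar \<Phi>" by blast
    then have mono: "strict_mono_on Jstar (\<lambda>u. - \<Phi> u)"
      by (auto simp: monotone_on_def)
    have inj: "inj_on \<Phi> Jstar"
      using strict_mono_on_imp_inj_on[OF mono] by (auto simp: inj_on_def)
    have M_eq: "M = the_inv_into Jstar \<Phi> (\<Phi> \<bar>sT\<bar> - 2 * ?c)"
      using False by (simp add: M slope_bound_def)
    have M': "M \<in> Jstar" "- \<Phi> M = - \<Phi> \<bar>sT\<bar> + 2 * ?c"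
      unfolding M_eq using the_inv_into_into[OF inj abs_in(2) order_refl]
        f_the_inv_into_f[OF inj abs_in(2)] by auto
    have "\<exists>x. half_line_solution J (\<lambda>u. - \<Phi> u) k (\<lambda>t x y. - f t x y) \<nu>1 \<nu>2 x"
      by (rule half_line_solution_increasing[OF continuous_on_minus[OF \<Phi>_cont] k_pos k_int
        caratheodory_uminus[OF f_car] kinf sT Jstar(1,3,4) mono _ T \<psi>_int M' nondegenerate])
        (use \<Phi>_odd f_bound in auto)
    then show ?thesis using half_line_solution_uminus by blast
  qed
qed

end
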